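(* Let $\tilde Z=(\tilde Z_n)_{n\ge0}$, $\tilde Z_n=\sum_{k=1}^n\xi_{S_k}\varepsilon_k$, be the first (horizontal) coordinate of the random walk in random environment $M=(M_n)_n=(\tilde Z_n,S_n)_n$ on $\mathbb Z^2$ described in the context. Below $T$ denotes a positive integer. There exists a constant $c>0$ such that for all large enough $T$ $$\mathbb P\Big[\max_{k=1,\ldots,T}\tilde Z_k\le 1\Big]\le T^{-1/4}(\log T)^{c}.$$ If moreover $\mathbb E[e^{\xi_1}]<\infty$, then there exist positive constants $c'$, $c''$ and $T_0$ such that $$T^{-1/4}(\log T)^{-c'}\left[H^{-1}\left(c''T^{-\frac14}\right)\right]^{-1}\le \mathbb P\Big[\max_{k=1,\ldots,T}\tilde Z_k\le 1\Big]$$ for every $T>T_0$, where $H(t):=\mathbb E[e^{\xi_1}\mathbf 1_{\{e^{\xi_1}>t\}}]$ and $H^{-1}(x):=\inf\{t>0: H(t)<x\}$ for every $x>0$.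
   Context: $(\xi_y)_{y\in\mathbb Z}$ is a sequence of i.i.d. $\mathbb Z$-valued random variables whose common distribution is symmetric, has a finite moment of order 3 and positive variance $\sigma_\xi^2$. $\nu$ is a probability distribution on $\mathbb Z$ with finite variance and null expectation, and $\delta\in(0,1)$ is a fixed parameter. Neither the support of $\nu$ nor the support of the distribution of $\xi_0$ is contained in a proper subgroup of $\mathbb Z$. Given $\xi$, the walk $M=(M_n)_n$ on $\mathbb Z^2$ starts from $M_0=(0,0)$ and has transitions $\mathbb P(M_{n+1}=(x+\xi_y,y)\mid M_n=(x,y))=\delta$ (horizontal displacement) and $\mathbb P(M_{n+1}=(x,y+z)\mid M_n=(x,y))=(1-\delta)\nu(\{z\})$, $z\in\mathbb Z$ (vertical displacement); that is, at each step it moves horizontally with probability $\delta$, and vertically (with displacement of law $\nu$) with probability $1-\delta$. It is represented as $$M_n=(\tilde Z_n,S_n),\qquad \tilde Z_n=\sum_{k=1}^n\xi_{S_k}\varepsilon_k,\qquad S_n=\sum_{k=1}^n\tilde X_k(1-\varepsilon_k),$$ where $(\tilde X_k)_{k\ge1}$ is a sequence of i.i.d. random variables with distribution $\nu$, $(\varepsilon_k)_{k\ge1}$ is a sequence of i.i.d. Bernoulli random variables with $\mathbb P(\varepsilon_k=1)=\delta=1-\mathbb P(\varepsilon_k=0)$, and the sequences $(\xi_y)_y$, $(\tilde X_k)_k$, $(\varepsilon_k)_k$ are independent. $\mathbb P$ is the annealed (joint) law of all these random variables, and $\mathbb E$ the corresponding expectation. *)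

theory Defs
  imports "HOL-Probability.Probability" "HOL-Algebra.Elementary_Groups"
begin

definition vertical :: "(nat \<Rightarrow> 'a \<Rightarrow> int) \<Rightarrow> (nat \<Rightarrow> 'a \<Rightarrow> int) \<Rightarrow> nat \<Rightarrow> 'a \<Rightarrow> int" where
  "vertical X \<epsilon> n \<omega> = (\<Sum>k=1..n. X k \<omega> * (1 - \<epsilon> k \<omega>))"

definition horizontal ::
    "(int \<Rightarrow> 'a \<Rightarrow> int) \<Rightarrow> (nat \<Rightarrow> 'a \<Rightarrow> int) \<Rightarrow> (nat \<Rightarrow> 'a \<Rightarrow> int) \<Rightarrow> nat \<Rightarrow> 'a \<Rightarrow> int" where
  "horizontal \<xi> X \<epsilon> n \<omega> = (\<Sum>k=1..n. \<xi> (vertical X \<epsilon> k \<omega>) \<omega> * \<epsilon> k \<omega>)"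

definition not_in_proper_subgroup :: "int set \<Rightarrow> bool" where
  "not_in_proper_subgroup A \<longleftrightarrow>
     (\<forall>H. subgroup H integer_group \<longrightarrow> A \<subseteq> H \<longrightarrow> H = carrier integer_group)"

text \<open>
  \<open>M\<close> carries the annealed law, \<open>\<mu>\<close> is the law of each \<open>\<xi> y\<close>. Every probability measure on the
  countable discrete space of integers is the measure of a \<open>pmf\<close>, so using \<open>int pmf\<close> for laws
  is no restriction. The assumption \<open>indep\<close> is joint: a single family, indexed by a disjoint sum,
  collects all \<open>\<xi> y\<close>, all \<open>X k\<close> and all \<open>\<epsilon> k\<close> with \<open>k \<ge> 1\<close>; it includes their measurability.
\<close>
locale rwre = prob_space M
  for M :: "'a measure" +
  fixes \<xi> :: "int \<Rightarrow> 'a \<Rightarrow> int"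
    and X :: "nat \<Rightarrow> 'a \<Rightarrow> int"
    and \<epsilon> :: "nat \<Rightarrow> 'a \<Rightarrow> int"
    and \<mu> :: "int pmf"
    and \<nu> :: "int pmf"
    and \<delta> :: real
  assumes delta: "0 < \<delta>" "\<delta> < 1"
    and indep: "indep_vars (\<lambda>_. count_space UNIV) (case_sum \<xi> (case_sum X \<epsilon>))
                  (UNIV <+> ({1..} <+> {1..}))"
    and xi_law: "\<And>y. distr M (count_space UNIV) (\<xi> y) = measure_pmf \<mu>"
    and X_law: "\<And>k. k \<ge> 1 \<Longrightarrow> distr M (count_space UNIV) (X k) = measure_pmf \<nu>"
    and eps_law: "\<And>k. k \<ge> 1 \<Longrightarrow>
          distr M (count_space UNIV) (\<epsilon> k) = measure_pmf (map_pmf of_bool (bernoulli_pmf \<delta>))"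
    and mu_symmetric: "map_pmf uminus \<mu> = \<mu>"
    and mu_third_moment: "integrable (measure_pmf \<mu>) (\<lambda>x. \<bar>real_of_int x\<bar> ^ 3)"
    and mu_variance_pos: "measure_pmf.variance \<mu> real_of_int > 0"
    and mu_support: "not_in_proper_subgroup (set_pmf \<mu>)"
    and nu_finite_variance: "integrable (measure_pmf \<nu>) (\<lambda>x. (real_of_int x)\<^sup>2)"
    and nu_centered: "measure_pmf.expectation \<nu> real_of_int = 0"
    and nu_support: "not_in_proper_subgroup (set_pmf \<nu>)"

definition exp_tail :: "'a measure \<Rightarrow> ('a \<Rightarrow> int) \<Rightarrow> real \<Rightarrow> real" where
  "exp_tail M Y t =
     (LINT \<omega>|M. exp (real_of_int (Y \<omega>)) * indicator {\<omega>. exp (real_of_int (Y \<omega>)) > t} \<omega>)"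

definition generalized_inverse :: "(real \<Rightarrow> real) \<Rightarrow> real \<Rightarrow> real" where
  "generalized_inverse H x = Inf {t. t > 0 \<and> H t < x}"

end

theory Submission
  imports Defs "HOL-Real_Asymp.Real_Asymp"
begin

text \<open>
  The first coordinate \<open>Z\<close> has stationary increments: seen from the height reached after some steps,
  the scenery has the same law as before. Let \<open>M\<^sub>n = max (0, Z\<^sub>1, ..., Z\<^sub>n)\<close>. Conditioning on the first step
  gives (\<open>mean_max_Suc\<close>)
  \<open>E M\<^sub>n\<^sub>+\<^sub>1 - E M\<^sub>n = \<delta> E (\<xi>\<^sub>0 + M\<^sub>n)\<^sup>-\<close>,
  where the negative part on the right, the undershoot, decreases with \<open>n\<close>. So \<open>E M\<^sub>n\<close> is concave in
  \<open>n\<close>. It is of order \<open>n powr (3/4)\<close> (\<open>mean_max_le\<close>, \<open>mean_max_ge\<close>), hence its increments are of order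
  \<open>n powr (-1/4)\<close>, and it remains to compare the mean undershoot with the probability of
  \<open>M\<^sub>n \<le> 1\<close>.

  For the upper bound the comparison costs only a constant. All values are integers, so the mean
  undershoot is at least the probability that \<open>\<xi>\<^sub>0 + M\<^sub>n \<le> - 1\<close>; and since \<open>M\<^sub>n\<close> increases with each site
  of the scenery, requiring a negative value at the starting site, once or twice, lowers the
  probability at most by a constant factor (\<open>harris_one_site\<close>). For the lower bound, the undershoot is
  positive only if \<open>\<xi>\<^sub>0 + M\<^sub>n \<le> - 1\<close>, and it is at most \<open>- \<xi>\<^sub>0\<close>; if the scenery has an exponential moment,
  cutting at \<open>ln n\<close> loses a term of order \<open>n powr (-1/2)\<close>. This gives \<open>n powr (-1/4) / ln n\<close> up to a
  constant (\<open>persistence_lower\<close>), and the factor given by the inverse of the exponential tail is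
  eventually at most \<open>1\<close>.

  The order \<open>n powr (3/4)\<close> is obtained as follows. Given the path, the variance of \<open>Z\<^sub>n\<close> is proportional to
  the number of coincidences among the heights of the horizontal steps. Its mean is at most of order
  \<open>n sqrt n\<close>, because a centred walk visits \<open>0\<close> at most of order \<open>sqrt n\<close> times: its absolute value is a
  submartingale that grows at every visit (\<open>tanaka_lower_bound\<close>). Doubling the time passes
  from \<open>Z\<^sub>n\<close> to \<open>M\<^sub>n\<close> (\<open>max_second_moment_double\<close>). In the other direction, the first moment of \<open>Z\<^sub>n\<close>, given the
  path, is at least a multiple of its standard deviation, by a bound on characteristic functions
  (\<open>sum_first_moment_ge\<close>); and at least half of the horizontal steps, in mean, take place at heights of
  order \<open>sqrt n\<close>, so that Cauchy--Schwarz bounds the number of coincidences from below (\<open>near_length_le\<close>).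
\<close>

section \<open>Maxima of partial sums\<close>

text \<open>
  The maximum of the partial sums, the empty one included. Applied to the scenery values read by
  the walk at its horizontal steps it gives the running maximum of the first coordinate, cut off
  at \<open>0\<close>.
\<close>
fun max_prefix_sum :: "int list \<Rightarrow> int" where
  "max_prefix_sum [] = 0"
| "max_prefix_sum (a # as) = max 0 (a + max_prefix_sum as)"

lemma max_prefix_sum_nonneg: "0 \<le> max_prefix_sum as"
  by (cases as) auto

lemma max_prefix_sum_append:
  "max_prefix_sum (as @ bs) = max (max_prefix_sum as) (sum_list as + max_prefix_sum bs)"
  by (induction as) (auto simp: max_def max_prefix_sum_nonneg)

lemma sum_list_le_max_prefix_sum: "sum_list as \<le> max_prefix_sum as"
  by (induction as) auto

lemma max_prefix_sum_mono:
  assumes "\<And>z. \<xi> z \<le> \<xi>' z"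
  shows "max_prefix_sum (map \<xi> ps) \<le> max_prefix_sum (map \<xi>' ps)"
proof (induction ps)
  case (Cons p ps)
  then show ?case using assms[of p] by (auto simp: max_def)
qed simp

text \<open>
  For \<open>z\<close> and \<open>t\<close> one has \<open>(z + t)\<^sup>2 \<le> 5 z\<^sup>2 + (5/4) t\<^sup>2\<close>, and a maximum of two squares is at most
  their sum. In the doubling recursion the weight of the old second moment becomes \<open>5/2\<close>, which
  is less than \<open>2 sqrt 2\<close>, the growth of \<open>n sqrt n\<close> when \<open>n\<close> doubles.
\<close>
lemma max_prefix_sum_append_square:
  "(real_of_int (max_prefix_sum (as @ bs)))\<^sup>2
    \<le> 5 * (real_of_int (sum_list as))\<^sup>2
      + 5/4 * ((real_of_int (max_prefix_sum as))\<^sup>2 + (real_of_int (max_prefix_sum bs))\<^sup>2)"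
proof -
  let ?z = "\<bar>real_of_int (sum_list as)\<bar>"
  let ?t = "max (real_of_int (max_prefix_sum as)) (real_of_int (max_prefix_sum bs))"
  have "real_of_int (max_prefix_sum (as @ bs)) \<le> ?z + ?t"
    by (auto simp: max_prefix_sum_append of_int_max)
  then have "(real_of_int (max_prefix_sum (as @ bs)))\<^sup>2 \<le> (?z + ?t)\<^sup>2"
    using max_prefix_sum_nonneg by (intro power_mono) auto
  also have "\<dots> \<le> 5 * ?z\<^sup>2 + 5/4 * ?t\<^sup>2"
    using zero_le_power2[of "2 * ?z - ?t / 2"] by (simp add: power2_eq_square algebra_simps)
  also have "?t\<^sup>2 \<le> (real_of_int (max_prefix_sum as))\<^sup>2 + (real_of_int (max_prefix_sum bs))\<^sup>2"
    by (auto simp: max_def)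
  finally show ?thesis by simp
qed

section \<open>Paths and the heights of their horizontal steps\<close>

text \<open>
  A path is the list of its steps: \<open>None\<close> is a horizontal step and \<open>Some x\<close> a vertical step by
  \<open>x\<close>. Only the heights of the horizontal steps matter for the first coordinate, so this list of
  heights (from starting height \<open>y\<close>) is all that the scenery has to be evaluated on.
\<close>
fun heights :: "int \<Rightarrow> int option list \<Rightarrow> int list" where
  "heights y [] = []"
| "heights y (None # l) = y # heights y l"
| "heights y (Some x # l) = heights (y + x) l"

fun rise :: "int option list \<Rightarrow> int" where
  "rise [] = 0"
| "rise (None # l) = rise l"
| "rise (Some x # l) = x + rise l"

lemma heights_append: "heights y (l @ l') = heights y l @ heights (y + rise l) l'"
  by (induction y l rule: heights.induct) (auto simp: add.assoc)

lemma heights_shift: "heights (a + y) l = map ((+) a) (heights y l)"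
  by (induction y l rule: heights.induct) (auto simp: add.assoc[symmetric])

lemma max_prefix_sum_extend:
  "max_prefix_sum (map \<xi> (heights y l)) \<le> max_prefix_sum (map \<xi> (heights y (l @ l')))"
  by (simp add: heights_append max_prefix_sum_append)

lemma max_prefix_sum_snoc:
  "max_prefix_sum (map \<xi> (heights y (l @ [s])))
    = max (max_prefix_sum (map \<xi> (heights y l))) (sum_list (map \<xi> (heights y (l @ [s]))))"
  using sum_list_le_max_prefix_sum[of "map \<xi> (heights y l)"]
  by (cases s) (auto simp: heights_append max_prefix_sum_append)

text \<open>
  The number of ordered pairs of positions in the list that carry the same height; the recursive
  form matches adding a step in front of a path.
\<close>
fun self_intersections :: "int list \<Rightarrow> nat" where
  "self_intersections [] = 0"
| "self_intersections (p # ps) = self_intersections ps + 1 + 2 * count_list ps p"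

lemma count_list_shift: "count_list (map ((+) a) ps) (a + p) = count_list ps (p::int)"
  by (induction ps) auto

lemma self_intersections_shift: "self_intersections (map ((+) a) ps) = self_intersections ps"
  by (induction ps) (auto simp: count_list_shift)

text \<open>
  The same count of coincidences as \<^const>\<open>self_intersections\<close>, organised by height.
\<close>
definition occupation :: "int list \<Rightarrow> real" where
  "occupation ps = (\<Sum>y\<in>set ps. (real (count_list ps y))\<^sup>2)"

lemma occupation_pos: "ps \<noteq> [] \<Longrightarrow> 0 < occupation ps"
  unfolding occupation_def by (intro sum_pos) (auto simp: count_list_0_iff)

lemma sum_list_eq_occupation_sum:
  assumes "finite S" "set ps \<subseteq> S"
  shows "real_of_int (sum_list (map \<xi> ps)) = (\<Sum>y\<in>S. real (count_list ps y) * real_of_int (\<xi> y))"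
  using assms(2)
proof (induction ps)
  case (Cons p ps)
  have "(\<Sum>y\<in>S. real (count_list (p # ps) y) * real_of_int (\<xi> y))
     = (\<Sum>y\<in>S. (if p = y then real_of_int (\<xi> y) else 0) + real (count_list ps y) * real_of_int (\<xi> y))"
    by (intro sum.cong) (auto simp: algebra_simps)
  also have "\<dots> = real_of_int (\<xi> p) + real_of_int (sum_list (map \<xi> ps))"
    using Cons assms(1) by (simp add: sum.distrib)
  finally show ?case by simp
qed simp

lemma count_list_filter: "count_list (filter P ps) y = (if P y then count_list ps y else 0)"
  by (induction ps) auto

text \<open>
  The Cauchy--Schwarz inequality over the \<open>2 R + 1\<close> heights in \<open>{- R..R}\<close>: many horizontal steps
  within few heights force a large occupation.
\<close>
lemma near_length_le:
  "real (length (filter (\<lambda>p. \<bar>real_of_int p\<bar> \<le> real R) ps)) \<le> sqrt (real (2 * R + 1)) * sqrt (occupation ps)"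
proof -
  let ?P = "\<lambda>p. \<bar>real_of_int p\<bar> \<le> real R"
  let ?S = "set (filter ?P ps)"
  have "real (length (filter ?P ps)) = (\<Sum>y\<in>?S. real (count_list (filter ?P ps) y))"
    by (subst sum_count_set[of "filter ?P ps" ?S, symmetric]) auto
  also have "\<dots> = (\<Sum>y\<in>?S. real (count_list ps y))"
    by (intro sum.cong) (auto simp: count_list_filter)
  finally have len: "real (length (filter ?P ps)) = (\<Sum>y\<in>?S. real (count_list ps y))" .
  have "card ?S \<le> card {- int R..int R}"
    by (intro card_mono) auto
  then have card: "real (card ?S) \<le> real (2 * R + 1)" by simp
  have "(\<Sum>y\<in>?S. real (count_list ps y))\<^sup>2 \<le> (\<Sum>y\<in>?S. (real (count_list ps y))\<^sup>2) * real (card ?S)"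
    by (rule sum_squared_le_sum_of_squares)
  also have "\<dots> \<le> occupation ps * real (2 * R + 1)"
    using card unfolding occupation_def by (intro mult_mono sum_mono2) (auto intro: sum_nonneg)
  finally have "(real (length (filter ?P ps)))\<^sup>2 \<le> real (2 * R + 1) * occupation ps"
    unfolding len by (simp only: mult.commute)
  then have "real (length (filter ?P ps)) \<le> sqrt (real (2 * R + 1) * occupation ps)"
    by (rule real_le_rsqrt)
  then show ?thesis by (simp only: real_sqrt_mult)
qed

section \<open>Elementary analytic and measure-theoretic facts\<close>

lemma abs_le_square: "\<bar>real_of_int x\<bar> \<le> (real_of_int x)\<^sup>2"
proof (cases "x = 0")
  case False
  then have "1 \<le> \<bar>real_of_int x\<bar>" by linarith
  from mult_left_mono[OF this, of "\<bar>real_of_int x\<bar>"] show ?thesis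
    by (simp add: power2_eq_square abs_mult[symmetric])
qed simp

text \<open>
  Young's inequality, used to pass from second to first moments inside integrals.
\<close>
lemma abs_le_quadratic:
  assumes "0 < (a::real)"
  shows "\<bar>s\<bar> \<le> (1 / (2 * a)) * s\<^sup>2 + a / 2"
proof -
  have "0 \<le> (\<bar>s\<bar> - a)\<^sup>2" by simp
  then have "2 * a * \<bar>s\<bar> \<le> s\<^sup>2 + a * a" by (simp add: power2_eq_square algebra_simps)
  then show ?thesis using assms by (simp add: field_simps)
qed

lemma one_minus_cos_le_abs: "1 - cos x \<le> \<bar>x\<bar>" for x :: real
proof -
  have "1 - cos x = 2 * \<bar>sin (x / 2)\<bar> * \<bar>sin (x / 2)\<bar>"
    using cos_double_sin[of "x / 2"] by (simp add: power2_eq_square abs_mult[symmetric])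
  also have "\<dots> \<le> 2 * \<bar>x / 2\<bar> * 1"
    using abs_sin_x_le_abs_x[of "x / 2"] by (intro mult_mono) auto
  finally show ?thesis by simp
qed

lemma cos_le_quadratic:
  fixes x :: real
  assumes "\<bar>x\<bar> \<le> 1"
  shows "cos x \<le> 1 - x\<^sup>2 / 4"
proof -
  define u where "u = \<bar>x\<bar> / 2"
  have u: "0 \<le> u" "u \<le> 1/2" using assms by (auto simp: u_def)
  have "\<bar>sin u - (\<Sum>m<3. sin_coeff m * u ^ m)\<bar> \<le> inverse (fact 3) * \<bar>u\<bar> ^ 3"
    by (rule Maclaurin_sin_bound)
  moreover have "(\<Sum>m<3. sin_coeff m * u ^ m) = u"
    by (simp add: eval_nat_numeral sin_coeff_def)
  ultimately have "\<bar>sin u - u\<bar> \<le> u ^ 3 / 6"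
    using u by (simp add: fact_numeral)
  then have "u - u ^ 3 / 6 \<le> sin u" by linarith
  moreover have "u ^ 3 \<le> u * (1/4)"
  proof -
    have "u * u \<le> (1/2) * (1/2)" using u by (intro mult_mono) auto
    then have "u * (u * u) \<le> u * (1/4)" using u by (intro mult_left_mono) auto
    then show ?thesis by (simp add: power3_eq_cube)
  qed
  ultimately have "(23/24) * u \<le> sin u" by simp
  then have "((23/24) * u)\<^sup>2 \<le> (sin u)\<^sup>2" using u by (intro power_mono) auto
  then have "529/576 * u\<^sup>2 \<le> (sin u)\<^sup>2" by (simp add: power_mult_distrib power_divide)
  then have "u\<^sup>2 / 2 \<le> (sin u)\<^sup>2" using zero_le_power2[of u] by linarith
  moreover have "cos x = 1 - 2 * (sin u)\<^sup>2"
    using cos_double_sin[of u] cos_abs_real[of x] by (simp add: u_def)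
  moreover have "u\<^sup>2 = x\<^sup>2 / 4" by (simp add: u_def power_divide)
  ultimately show ?thesis by simp
qed

lemma sqrt_sqrt_powr: "0 < x \<Longrightarrow> sqrt (x * sqrt x) = x powr (3/4)" for x :: real
  by (simp add: powr_half_sqrt[symmetric] powr_mult powr_powr powr_add[symmetric])

lemma ennreal_pos_part_identity:
  assumes "0 \<le> m"
  shows "ennreal (max 0 (a + m)) + ennreal (- a) = (ennreal a + ennreal m) + ennreal (- (a + m))"
proof -
  have e: "ennreal x = ennreal (max 0 x)" for x by (simp add: max_def ennreal_neg)
  show ?thesis
    using assms unfolding e[of "- a"] e[of a] e[of "- (a + m)"]
    by (subst ennreal_plus[symmetric]; auto simp: max_def simp del: ennreal_plus simp flip: ennreal_plus)
qed

text \<open>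
  Lists over a countable type form a countable set, so a list of discrete random variables is
  again a discrete random variable. This makes every functional of finitely many sites measurable
  at once.
\<close>
lemma map_measurable:
  fixes g :: "'b \<Rightarrow> 'c \<Rightarrow> 'd::countable"
  assumes [measurable]: "\<And>p. p \<in> set ps \<Longrightarrow> g p \<in> measurable N (count_space UNIV)"
  shows "(\<lambda>\<omega>. map (\<lambda>p. g p \<omega>) ps) \<in> measurable N (count_space UNIV)"
proof (rule measurableI, goal_cases)
  case (2 A)
  have m: "{\<omega>\<in>space N. \<forall>i\<in>{..<length ps}. g (ps ! i) \<omega> = l ! i} \<in> sets N" for l
    by measurable
  have "(\<lambda>\<omega>. map (\<lambda>p. g p \<omega>) ps) -` A \<inter> space N
      = (\<Union>l\<in>{l\<in>A. length l = length ps}. {\<omega>\<in>space N. \<forall>i\<in>{..<length ps}. g (ps ! i) \<omega> = l ! i})"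
    by (auto simp: list_eq_iff_nth_eq)
       (metis (no_types, lifting) length_map lessThan_iff nth_equalityI nth_map)
  also have "\<dots> \<in> sets N"
    by (intro sets.countable_UN' m) auto
  finally show ?case .
qed auto

lemma pmf_replicate_Cons:
  "pmf (replicate_pmf (Suc n) p) (x # xs) = pmf p x * pmf (replicate_pmf n p) xs"
proof -
  have "replicate_pmf (Suc n) p = map_pmf (\<lambda>(x, xs). x # xs) (pair_pmf p (replicate_pmf n p))"
    by (simp add: pair_pmf_def map_bind_pmf)
  then have "pmf (replicate_pmf (Suc n) p) (x # xs) = pmf (pair_pmf p (replicate_pmf n p)) (x, xs)"
    using pmf_map_inj'[of "\<lambda>(x, xs). x # xs" "pair_pmf p (replicate_pmf n p)" "(x, xs)"]
    by (simp add: inj_on_def)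
  then show ?thesis by (simp add: pmf_pair)
qed

lemma pmf_replicate:
  "length xs = n \<Longrightarrow> pmf (replicate_pmf n p) xs = (\<Prod>i<n. pmf p (xs ! i))"
proof (induction n arbitrary: xs)
  case (Suc n)
  then obtain x ys where xs: "xs = x # ys" "length ys = n" by (cases xs) auto
  show ?case
    unfolding xs(1) pmf_replicate_Cons Suc.IH[OF xs(2)]
    by (subst prod.lessThan_Suc_shift) simp
qed simp

section \<open>The random scenery and the random path\<close>

text \<open>
  The laws alone: the random scenery and the random path are realised below on separate spaces,
  so that averages over the scenery for a given path (quenched) come before averages over paths.
\<close>
locale scenery_walk =
  fixes \<mu> \<nu> :: "int pmf" and \<delta> :: real
  assumes delta: "0 < \<delta>" "\<delta> < 1"
    and mu_symmetric: "map_pmf uminus \<mu> = \<mu>"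
    and mu_square: "integrable (measure_pmf \<mu>) (\<lambda>x. (real_of_int x)\<^sup>2)"
    and mu_nontrivial: "\<exists>v>0. v \<in> set_pmf \<mu>"
    and nu_square: "integrable (measure_pmf \<nu>) (\<lambda>x. (real_of_int x)\<^sup>2)"
    and nu_centered: "measure_pmf.expectation \<nu> real_of_int = 0"
    and nu_nontrivial: "\<exists>x\<in>set_pmf \<nu>. x \<noteq> 0"
begin

definition scenery :: "(int \<Rightarrow> int) measure" where
  "scenery = PiM UNIV (\<lambda>_. measure_pmf \<mu>)"

sublocale scenery: prob_space scenery
  unfolding scenery_def by (intro prob_space_PiM) (rule measure_pmf.prob_space_axioms)

lemma space_scenery [simp]: "space scenery = UNIV"
  by (auto simp: scenery_def space_PiM)

lemma coordinate_measurable_discrete [measurable]: "(\<lambda>\<xi>. \<xi> p) \<in> measurable scenery (count_space UNIV)"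
proof -
  have "(\<lambda>\<xi>. \<xi> p) \<in> measurable scenery (measure_pmf \<mu>)"
    unfolding scenery_def by (rule measurable_component_singleton) simp
  then show ?thesis by simp
qed

lemma coordinate_measurable:
  assumes "\<And>x. f x \<in> space N"
  shows "(\<lambda>\<xi>. f (\<xi> p)) \<in> measurable scenery N"
  using assms by (intro measurable_compose[OF coordinate_measurable_discrete]) auto

lemma distr_coordinate: "distr scenery (measure_pmf \<mu>) (\<lambda>\<xi>. \<xi> p) = measure_pmf \<mu>"
  unfolding scenery_def
  by (rule distr_PiM_component) (auto intro: measure_pmf.prob_space_axioms)

lemma sample_measurable_discrete [measurable]: "(\<lambda>\<xi>. map \<xi> ps) \<in> measurable scenery (count_space UNIV)"
  using map_measurable[of ps "\<lambda>p \<xi>. \<xi> p" scenery] coordinate_measurable_discrete by simp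

lemma sample_measurable:
  assumes "\<And>x. F x \<in> space N"
  shows "(\<lambda>\<xi>. F (map \<xi> ps)) \<in> measurable scenery N"
  using assms by (intro measurable_compose[OF sample_measurable_discrete]) auto

lemma nn_integral_coordinate:
  "(\<integral>\<^sup>+\<xi>. f (\<xi> p) \<partial>scenery) = (\<integral>\<^sup>+x. f x \<partial>measure_pmf \<mu>)"
  by (subst distr_coordinate[of p, symmetric], subst nn_integral_distr) (auto intro: coordinate_measurable)

lemma integral_coordinate:
  fixes f :: "int \<Rightarrow> real"
  shows "(\<integral>\<xi>. f (\<xi> p) \<partial>scenery) = (\<integral>x. f x \<partial>measure_pmf \<mu>)"
  by (subst distr_coordinate[of p, symmetric], subst integral_distr) (auto intro: coordinate_measurable)

lemma integrable_coordinate: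
  fixes f :: "int \<Rightarrow> real"
  shows "integrable scenery (\<lambda>\<xi>. f (\<xi> p)) \<longleftrightarrow> integrable (measure_pmf \<mu>) f"
  by (subst distr_coordinate[of p, symmetric], subst integrable_distr_eq) (auto intro: coordinate_measurable)

text \<open>
  Translation invariance of the i.i.d. scenery. It is the source of the stationarity of the
  increments: the scenery seen from a new height has the old law.
\<close>
lemma sample_shift:
  "(\<integral>\<^sup>+\<xi>. F (map \<xi> (map ((+) a) ps)) \<partial>scenery) = (\<integral>\<^sup>+\<xi>. F (map \<xi> ps) \<partial>scenery)"
proof -
  have d: "distr scenery scenery (\<lambda>\<xi>. \<lambda>n\<in>UNIV. \<xi> (a + n)) = scenery"
    unfolding scenery_def
    by (rule distr_PiM_reindex[of UNIV "\<lambda>_. measure_pmf \<mu>" "\<lambda>n. a + n" UNIV])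
       (auto intro: measure_pmf.prob_space_axioms)
  have "(\<integral>\<^sup>+\<xi>. F (map \<xi> ps) \<partial>scenery)
     = (\<integral>\<^sup>+\<xi>. F (map \<xi> ps) \<partial>distr scenery scenery (\<lambda>\<xi>. \<lambda>n\<in>UNIV. \<xi> (a + n)))"
    by (simp only: d)
  also have "\<dots> = (\<integral>\<^sup>+\<xi>. F (map (\<lambda>n\<in>UNIV. \<xi> (a + n)) ps) \<partial>scenery)"
    by (subst nn_integral_distr)
       (auto simp: scenery_def intro!: measurable_restrict sample_measurable[unfolded scenery_def])
  also have "\<dots> = (\<integral>\<^sup>+\<xi>. F (map \<xi> (map ((+) a) ps)) \<partial>scenery)"
    by (simp add: comp_def restrict_def)
  finally show ?thesis ..
qed

lemma indep_coordinates: "scenery.indep_vars (\<lambda>_. measure_pmf \<mu>) (\<lambda>p \<xi>. \<xi> p) UNIV"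
proof -
  have "distr scenery (PiM UNIV (\<lambda>_. measure_pmf \<mu>)) (\<lambda>x. \<lambda>i\<in>UNIV. x i) = PiM UNIV (\<lambda>i. distr scenery (measure_pmf \<mu>) (\<lambda>x. x i))"
    unfolding distr_coordinate
    by (simp add: restrict_def scenery_def[symmetric] distr_id)
  then show ?thesis
    by (subst scenery.indep_vars_iff_distr_eq_PiM) auto
qed

definition step :: "int option pmf" where
  "step = bind_pmf (bernoulli_pmf \<delta>) (\<lambda>b. if b then return_pmf None else map_pmf Some \<nu>)"

abbreviation paths :: "nat \<Rightarrow> int option list pmf" where
  "paths n \<equiv> replicate_pmf n step"

lemma nn_integral_step:
  fixes f :: "int option \<Rightarrow> ennreal"
  shows "(\<integral>\<^sup>+s. f s \<partial>measure_pmf step) = ennreal \<delta> * f None + ennreal (1 - \<delta>) * (\<integral>\<^sup>+x. f (Some x) \<partial>measure_pmf \<nu>)"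
  using delta by (simp add: step_def mult.commute)

lemma nn_integral_paths_Suc:
  fixes f :: "int option list \<Rightarrow> ennreal"
  shows "(\<integral>\<^sup>+l. f l \<partial>measure_pmf (paths (Suc n))) =
    ennreal \<delta> * (\<integral>\<^sup>+l. f (None # l) \<partial>measure_pmf (paths n))
    + ennreal (1 - \<delta>) * (\<integral>\<^sup>+x. \<integral>\<^sup>+l. f (Some x # l) \<partial>measure_pmf (paths n) \<partial>measure_pmf \<nu>)"
  by (simp add: nn_integral_step)

lemma nn_integral_paths_add:
  fixes f :: "int option list \<Rightarrow> ennreal"
  shows "(\<integral>\<^sup>+l. f l \<partial>measure_pmf (paths (m + n))) =
    (\<integral>\<^sup>+l. \<integral>\<^sup>+l'. f (l @ l') \<partial>measure_pmf (paths n) \<partial>measure_pmf (paths m))"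
  by (simp add: replicate_pmf_distrib)

lemma sample_heights:
  "(\<integral>\<^sup>+\<xi>. F (map \<xi> (heights y l)) \<partial>scenery) = (\<integral>\<^sup>+\<xi>. F (map \<xi> (heights 0 l)) \<partial>scenery)"
  using sample_shift[of F y "heights 0 l"] heights_shift[of y 0 l] by simp

lemma two_point_measurable:
  assumes "\<And>a as. F a as \<in> space N"
  shows "(\<lambda>\<xi>. F (\<xi> p) (map \<xi> ps)) \<in> measurable scenery N"
  using sample_measurable[of "\<lambda>as. F (hd as) (tl as)" N "p # ps"] assms by simp

lemma mu_reflect: "(\<integral>\<^sup>+x. f (- x) \<partial>measure_pmf \<mu>) = (\<integral>\<^sup>+x. f x \<partial>measure_pmf \<mu>)"
  by (subst (2) mu_symmetric[symmetric]) simp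

lemma integrable_mu: "integrable (measure_pmf \<mu>) real_of_int"
  by (rule Bochner_Integration.integrable_bound[OF mu_square]) (auto simp: abs_le_square)

lemma integrable_nu: "integrable (measure_pmf \<nu>) real_of_int"
  by (rule Bochner_Integration.integrable_bound[OF nu_square]) (auto simp: abs_le_square)

lemma mu_centered: "measure_pmf.expectation \<mu> real_of_int = 0"
proof -
  have "measure_pmf.expectation \<mu> real_of_int = measure_pmf.expectation (map_pmf uminus \<mu>) real_of_int"
    by (simp add: mu_symmetric)
  also have "\<dots> = - measure_pmf.expectation \<mu> real_of_int"
    by simp
  finally show ?thesis by simp
qed

lemma mu_pos_part_finite: "(\<integral>\<^sup>+x. ennreal (real_of_int x) \<partial>measure_pmf \<mu>) < \<infinity>"
proof -
  have "(\<integral>\<^sup>+x. ennreal (real_of_int x) \<partial>measure_pmf \<mu>) \<le> (\<integral>\<^sup>+x. ennreal (norm (real_of_int x)) \<partial>measure_pmf \<mu>)"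
    by (intro nn_integral_mono) (auto intro: ennreal_leI)
  also have "\<dots> < \<infinity>"
    using integrable_mu unfolding integrable_iff_bounded by simp
  finally show ?thesis .
qed

section \<open>Concavity of the mean maximum\<close>

definition mean_max :: "nat \<Rightarrow> ennreal" where
  "mean_max n = (\<integral>\<^sup>+l. \<integral>\<^sup>+\<xi>. ennreal (real_of_int (max_prefix_sum (map \<xi> (heights 0 l)))) \<partial>scenery \<partial>measure_pmf (paths n))"

text \<open>
  The coercion to \<^typ>\<open>ennreal\<close> keeps only the negative part of \<open>\<xi> 0 + m\<close>.
\<close>
definition mean_undershoot :: "nat \<Rightarrow> ennreal" where
  "mean_undershoot n = (\<integral>\<^sup>+l. \<integral>\<^sup>+\<xi>. ennreal (- real_of_int (\<xi> 0 + max_prefix_sum (map \<xi> (heights 0 l)))) \<partial>scenery \<partial>measure_pmf (paths n))"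

text \<open>
  All integrals are over nonnegative functions; the two halves of \<open>\<xi> p\<close> have the same finite
  mean by symmetry and cancel.
\<close>
lemma quenched_increment:
  "(\<integral>\<^sup>+\<xi>. ennreal (real_of_int (max_prefix_sum (map \<xi> (p # ps)))) \<partial>scenery)
   = (\<integral>\<^sup>+\<xi>. ennreal (real_of_int (max_prefix_sum (map \<xi> ps))) \<partial>scenery)
   + (\<integral>\<^sup>+\<xi>. ennreal (- real_of_int (\<xi> p + max_prefix_sum (map \<xi> ps))) \<partial>scenery)" (is "?a = ?m + ?g")
proof -
  let ?e = "\<integral>\<^sup>+x. ennreal (real_of_int x) \<partial>measure_pmf \<mu>"
  have e1: "(\<integral>\<^sup>+\<xi>. ennreal (real_of_int (\<xi> p)) \<partial>scenery) = ?e"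
    by (rule nn_integral_coordinate)
  have e2: "(\<integral>\<^sup>+\<xi>. ennreal (- real_of_int (\<xi> p)) \<partial>scenery) = ?e"
    using nn_integral_coordinate[of "\<lambda>x. ennreal (- real_of_int x)" p] mu_reflect[of "\<lambda>x. ennreal (real_of_int x)"]
    by simp
  have m1: "(\<lambda>\<xi>. ennreal (real_of_int (max_prefix_sum (map \<xi> ps)))) \<in> borel_measurable scenery" for ps
    by (rule sample_measurable) simp
  have m2: "(\<lambda>\<xi>. ennreal (- real_of_int (\<xi> p + max_prefix_sum (map \<xi> ps)))) \<in> borel_measurable scenery"
    by (rule two_point_measurable) simp
  have m3: "(\<lambda>\<xi>. ennreal (real_of_int (\<xi> p))) \<in> borel_measurable scenery" "(\<lambda>\<xi>. ennreal (- real_of_int (\<xi> p))) \<in> borel_measurable scenery"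
    by (auto intro: coordinate_measurable)
  have "?a + ?e = (\<integral>\<^sup>+\<xi>. ennreal (real_of_int (max_prefix_sum (map \<xi> (p # ps)))) + ennreal (- real_of_int (\<xi> p)) \<partial>scenery)"
    using nn_integral_add[OF m1 m3(2), of "p # ps"] by (simp add: e2)
  also have "\<dots> = (\<integral>\<^sup>+\<xi>. (ennreal (real_of_int (\<xi> p)) + ennreal (real_of_int (max_prefix_sum (map \<xi> ps))))
        + ennreal (- real_of_int (\<xi> p + max_prefix_sum (map \<xi> ps))) \<partial>scenery)"
    by (intro nn_integral_cong)
       (use ennreal_pos_part_identity in \<open>simp add: max_prefix_sum_nonneg of_int_max\<close>)
  also have "\<dots> = (?e + ?m) + ?g"
    using m1 m2 m3 by (simp add: nn_integral_add e1)
  finally have "?e + ?a = ?e + (?m + ?g)" by (simp add: ac_simps)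
  then show ?thesis
    using mu_pos_part_finite by (simp only: ennreal_add_left_cancel infinity_ennreal_def) auto
qed

text \<open>
  The key identity. A vertical first step leaves the law of the maximum unchanged by
  translation invariance; a horizontal one replaces the maximum \<open>m\<close> by the positive part of
  \<open>\<xi> 0 + m\<close>, whose mean exceeds that of \<open>m\<close> by the mean of the negative part, the scenery being
  centred.
\<close>
lemma mean_max_Suc: "mean_max (Suc n) = mean_max n + ennreal \<delta> * mean_undershoot n"
proof -
  have "mean_max (Suc n) = ennreal \<delta> * (mean_max n + mean_undershoot n) + ennreal (1 - \<delta>) * mean_max n"
    unfolding mean_max_def nn_integral_paths_Suc mean_undershoot_def
    by (simp only: heights.simps quenched_increment sample_heights[of "\<lambda>as. ennreal (real_of_int (max_prefix_sum as))" "0 + _"])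
       (simp add: nn_integral_add)
  also have "\<dots> = (ennreal \<delta> + ennreal (1 - \<delta>)) * mean_max n + ennreal \<delta> * mean_undershoot n"
    by (simp add: algebra_simps)
  also have "ennreal \<delta> + ennreal (1 - \<delta>) = 1"
    using delta by (simp flip: ennreal_plus)
  finally show ?thesis by simp
qed

text \<open>
  The maximum can only grow along the path. With the identity above this says that
  \<^term>\<open>mean_max\<close> is concave, which turns estimates of its size into estimates of its increments,
  both from above and from below.
\<close>
lemma mean_undershoot_decreasing: "mean_undershoot (n + k) \<le> mean_undershoot n"
proof -
  have "mean_undershoot (n + k) \<le> (\<integral>\<^sup>+l. \<integral>\<^sup>+l'. \<integral>\<^sup>+\<xi>. ennreal (- real_of_int (\<xi> 0 + max_prefix_sum (map \<xi> (heights 0 l)))) \<partial>scenery \<partial>measure_pmf (paths k) \<partial>measure_pmf (paths n))"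
    unfolding mean_undershoot_def nn_integral_paths_add
    by (intro nn_integral_mono ennreal_leI) (simp add: max_prefix_sum_extend)
  then show ?thesis by (simp add: mean_undershoot_def)
qed

lemma mean_max_mono: "mean_max n \<le> mean_max (n + k)"
proof -
  have "(\<integral>\<^sup>+l. \<integral>\<^sup>+l'. \<integral>\<^sup>+\<xi>. ennreal (real_of_int (max_prefix_sum (map \<xi> (heights 0 l)))) \<partial>scenery \<partial>measure_pmf (paths k) \<partial>measure_pmf (paths n)) \<le> mean_max (n + k)"
    unfolding mean_max_def nn_integral_paths_add
    by (intro nn_integral_mono ennreal_leI) (simp add: max_prefix_sum_extend)
  then show ?thesis by (simp add: mean_max_def)
qed

lemma mean_max_add_le: "mean_max (n + k) \<le> mean_max n + of_nat k * (ennreal \<delta> * mean_undershoot n)"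
proof (induction k)
  case (Suc k)
  have "mean_max (n + Suc k) = mean_max (n + k) + ennreal \<delta> * mean_undershoot (n + k)"
    using mean_max_Suc[of "n + k"] by simp
  also have "\<dots> \<le> (mean_max n + of_nat k * (ennreal \<delta> * mean_undershoot n)) + ennreal \<delta> * mean_undershoot n"
    by (intro add_mono Suc.IH mult_left_mono mean_undershoot_decreasing) auto
  finally show ?case by (simp add: algebra_simps)
qed simp

lemma mean_undershoot_le: "of_nat n * (ennreal \<delta> * mean_undershoot n) \<le> mean_max n"
proof -
  have "of_nat k * (ennreal \<delta> * mean_undershoot n) \<le> mean_max k" if "k \<le> n" for k
    using that
  proof (induction k)
    case (Suc k)
    have "mean_undershoot n \<le> mean_undershoot k"
      using mean_undershoot_decreasing[of k "n - k"] Suc.prems by simp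
    then have "of_nat k * (ennreal \<delta> * mean_undershoot n) + ennreal \<delta> * mean_undershoot n
        \<le> mean_max k + ennreal \<delta> * mean_undershoot k"
      using Suc by (intro add_mono mult_left_mono) auto
    then show ?case by (simp add: mean_max_Suc algebra_simps)
  qed simp
  then show ?thesis by simp
qed

section \<open>Visits to a height\<close>

definition nu_second :: real where
  "nu_second = measure_pmf.expectation \<nu> (\<lambda>x. (real_of_int x)\<^sup>2)"

definition nu_first :: real where
  "nu_first = measure_pmf.expectation \<nu> (\<lambda>x. \<bar>real_of_int x\<bar>)"

definition mu_second :: real where
  "mu_second = measure_pmf.expectation \<mu> (\<lambda>x. (real_of_int x)\<^sup>2)"

lemma nu_second_nonneg: "0 \<le> nu_second"
  unfolding nu_second_def by (rule integral_nonneg_AE) simp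

lemma mu_second_nonneg: "0 \<le> mu_second"
  unfolding mu_second_def by (rule integral_nonneg_AE) simp

lemma nu_first_pos: "0 < nu_first"
proof -
  obtain x where x: "x \<in> set_pmf \<nu>" "x \<noteq> 0" using nu_nontrivial by blast
  have "0 \<le> nu_first"
    unfolding nu_first_def by (rule integral_nonneg_AE) simp
  moreover have "nu_first \<noteq> 0"
  proof
    assume "nu_first = 0"
    then have "AE x in measure_pmf \<nu>. \<bar>real_of_int x\<bar> = 0"
      using integrable_nu unfolding nu_first_def
      by (subst (asm) integral_nonneg_eq_0_iff_AE) (auto intro: integrable_abs)
    then show False using x by (auto simp: AE_measure_pmf_iff)
  qed
  ultimately show ?thesis by simp
qed

lemma ennreal_mixture_same: "ennreal \<delta> * a + ennreal (1 - \<delta>) * a = a"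
proof -
  have "ennreal \<delta> + ennreal (1 - \<delta>) = 1" using delta by (simp flip: ennreal_plus)
  then show ?thesis by (simp flip: distrib_right)
qed

lemma ennreal_mixture:
  assumes "0 \<le> a" "0 \<le> b"
  shows "ennreal \<delta> * ennreal a + ennreal (1 - \<delta>) * ennreal b = ennreal (\<delta> * a + (1 - \<delta>) * b)"
  using assms delta by (simp flip: ennreal_mult ennreal_plus)

lemma nn_integral_nu_square:
  assumes "0 \<le> k"
  shows "(\<integral>\<^sup>+x. ennreal ((real_of_int (y + x))\<^sup>2 + k) \<partial>measure_pmf \<nu>) = ennreal ((real_of_int y)\<^sup>2 + nu_second + k)"
proof -
  have eq: "(real_of_int (y + x))\<^sup>2 + k = (real_of_int x)\<^sup>2 + (2 * real_of_int y * real_of_int x + ((real_of_int y)\<^sup>2 + k))" for x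
    by (simp add: power2_eq_square algebra_simps)
  have int: "integrable (measure_pmf \<nu>) (\<lambda>x. (real_of_int (y + x))\<^sup>2 + k)"
    unfolding eq using nu_square integrable_nu by auto
  have "(\<integral>\<^sup>+x. ennreal ((real_of_int (y + x))\<^sup>2 + k) \<partial>measure_pmf \<nu>)
     = ennreal (measure_pmf.expectation \<nu> (\<lambda>x. (real_of_int (y + x))\<^sup>2 + k))"
    using int assms by (intro nn_integral_eq_integral) (auto simp del: of_int_add)
  also have "measure_pmf.expectation \<nu> (\<lambda>x. (real_of_int (y + x))\<^sup>2 + k) = (real_of_int y)\<^sup>2 + nu_second + k"
    unfolding eq using nu_square integrable_nu by (simp add: nu_second_def nu_centered)
  finally show ?thesis .
qed

lemma rise_second_moment:
  "(\<integral>\<^sup>+l. ennreal ((real_of_int (y + rise l))\<^sup>2) \<partial>measure_pmf (paths n))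
    = ennreal ((real_of_int y)\<^sup>2 + real n * ((1 - \<delta>) * nu_second))"
proof (induction n arbitrary: y)
  case (Suc n)
  let ?c = "(1 - \<delta>) * nu_second"
  have c: "0 \<le> ?c" using delta nu_second_nonneg by simp
  have "(\<integral>\<^sup>+l. ennreal ((real_of_int (y + rise l))\<^sup>2) \<partial>measure_pmf (paths (Suc n)))
    = ennreal \<delta> * ennreal ((real_of_int y)\<^sup>2 + real n * ?c)
      + ennreal (1 - \<delta>) * ennreal ((real_of_int y)\<^sup>2 + nu_second + real n * ?c)"
    unfolding nn_integral_paths_Suc rise.simps add.assoc[symmetric] Suc.IH
    using c by (simp only: nn_integral_nu_square mult_nonneg_nonneg of_nat_0_le_iff)
  also have "\<dots> = ennreal (\<delta> * ((real_of_int y)\<^sup>2 + real n * ?c) + (1 - \<delta>) * ((real_of_int y)\<^sup>2 + nu_second + real n * ?c))"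
    using c nu_second_nonneg by (intro ennreal_mixture) auto
  finally show ?case by (simp add: algebra_simps)
qed simp

text \<open>
  The mean increase of the absolute height in a step from height \<open>0\<close>, divided by the probability
  of a horizontal step: the local time is counted here in horizontal steps only.
\<close>
definition tanaka_rate :: real where
  "tanaka_rate = (1 - \<delta>) * nu_first / \<delta>"

lemma tanaka_rate_pos: "0 < tanaka_rate"
  using nu_first_pos delta by (simp add: tanaka_rate_def)

lemma tanaka_step:
  "\<bar>real_of_int y\<bar> + tanaka_rate * (\<delta> * (if y = 0 then 1 else 0))
     \<le> \<delta> * \<bar>real_of_int y\<bar> + (1 - \<delta>) * measure_pmf.expectation \<nu> (\<lambda>x. \<bar>real_of_int (y + x)\<bar>)"
proof (cases "y = 0")
  case True
  then show ?thesis using delta by (simp add: tanaka_rate_def nu_first_def)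
next
  case False
  have "\<bar>measure_pmf.expectation \<nu> (\<lambda>x. real_of_int (y + x))\<bar> \<le> measure_pmf.expectation \<nu> (\<lambda>x. \<bar>real_of_int (y + x)\<bar>)"
    using integral_abs_bound[of "measure_pmf \<nu>" "\<lambda>x. real_of_int (y + x)"] by simp
  moreover have "measure_pmf.expectation \<nu> (\<lambda>x. real_of_int (y + x)) = real_of_int y"
    using integrable_nu by (simp add: nu_centered)
  ultimately have "\<bar>real_of_int y\<bar> \<le> measure_pmf.expectation \<nu> (\<lambda>x. \<bar>real_of_int (y + x)\<bar>)" by (simp only:)
  from mult_left_mono[OF this, of "1 - \<delta>"] show ?thesis using False delta by (simp add: algebra_simps)
qed

abbreviation mean_visits :: "nat \<Rightarrow> int \<Rightarrow> ennreal" where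
  "mean_visits n y \<equiv> (\<integral>\<^sup>+l. ennreal (real (count_list (heights y l) 0)) \<partial>measure_pmf (paths n))"

text \<open>
  A discrete Tanaka formula. The height is a centred walk, so its absolute value is a
  submartingale, and it gains a fixed amount in mean at each visit to \<open>0\<close>. Hence the expected number
  of visits is at most a multiple of the mean absolute height, that is of \<open>sqrt n\<close>.
\<close>
lemma tanaka_lower_bound:
  "ennreal \<bar>real_of_int y\<bar> + ennreal tanaka_rate * mean_visits n y
     \<le> (\<integral>\<^sup>+l. ennreal \<bar>real_of_int (y + rise l)\<bar> \<partial>measure_pmf (paths n))"
proof (induction n arbitrary: y)
  case (Suc n)
  let ?e = "measure_pmf.expectation \<nu> (\<lambda>x. \<bar>real_of_int (y + x)\<bar>)"
  let ?i = "if y = 0 then 1 else (0::real)"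
  let ?V = "\<integral>\<^sup>+x. mean_visits n (y + x) \<partial>measure_pmf \<nu>"
  have int: "integrable (measure_pmf \<nu>) (\<lambda>x. \<bar>real_of_int (y + x)\<bar>)"
    using integrable_nu by (intro integrable_abs) simp
  have e: "(\<integral>\<^sup>+x. ennreal \<bar>real_of_int (y + x)\<bar> \<partial>measure_pmf \<nu>) = ennreal ?e" "0 \<le> ?e"
    using int by (auto intro!: nn_integral_eq_integral integral_nonneg_AE)
  have "mean_visits (Suc n) y = ennreal \<delta> * (\<integral>\<^sup>+l. ennreal ?i + ennreal (real (count_list (heights y l) 0)) \<partial>measure_pmf (paths n))
      + ennreal (1 - \<delta>) * ?V"
    unfolding nn_integral_paths_Suc heights.simps
    by (intro arg_cong2[where f="(+)"] arg_cong2[where f="(*)"] nn_integral_cong refl)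
       (auto simp flip: ennreal_plus)
  also have "\<dots> = ennreal \<delta> * (ennreal ?i + mean_visits n y) + ennreal (1 - \<delta>) * ?V"
    by (subst nn_integral_add) auto
  finally have "ennreal \<bar>real_of_int y\<bar> + ennreal tanaka_rate * mean_visits (Suc n) y
     = (ennreal \<bar>real_of_int y\<bar> + ennreal tanaka_rate * (ennreal \<delta> * ennreal ?i))
       + ennreal tanaka_rate * (ennreal \<delta> * mean_visits n y + ennreal (1 - \<delta>) * ?V)"
    by (simp add: algebra_simps)
  also have "ennreal \<bar>real_of_int y\<bar> + ennreal tanaka_rate * (ennreal \<delta> * ennreal ?i)
      = ennreal (\<bar>real_of_int y\<bar> + tanaka_rate * (\<delta> * ?i))"
    using delta tanaka_rate_pos by (simp flip: ennreal_mult ennreal_plus)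
  also have "\<dots> \<le> ennreal (\<delta> * \<bar>real_of_int y\<bar> + (1 - \<delta>) * ?e)"
    by (intro ennreal_leI tanaka_step)
  also have "\<dots> = ennreal \<delta> * ennreal \<bar>real_of_int y\<bar> + ennreal (1 - \<delta>) * ennreal ?e"
    using e(2) by (intro ennreal_mixture[symmetric]) auto
  also have "\<dots> + ennreal tanaka_rate * (ennreal \<delta> * mean_visits n y + ennreal (1 - \<delta>) * ?V)
     = ennreal \<delta> * (ennreal \<bar>real_of_int y\<bar> + ennreal tanaka_rate * mean_visits n y)
      + ennreal (1 - \<delta>) * (\<integral>\<^sup>+x. ennreal \<bar>real_of_int (y + x)\<bar> + ennreal tanaka_rate * mean_visits n (y + x) \<partial>measure_pmf \<nu>)"
    unfolding e(1)[symmetric] by (simp add: nn_integral_add nn_integral_cmult algebra_simps)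
  also have "\<dots> \<le> ennreal \<delta> * (\<integral>\<^sup>+l. ennreal \<bar>real_of_int (y + rise l)\<bar> \<partial>measure_pmf (paths n))
      + ennreal (1 - \<delta>) * (\<integral>\<^sup>+x. \<integral>\<^sup>+l. ennreal \<bar>real_of_int ((y + x) + rise l)\<bar> \<partial>measure_pmf (paths n) \<partial>measure_pmf \<nu>)"
    by (intro add_mono mult_left_mono Suc.IH nn_integral_mono) auto
  also have "\<dots> = (\<integral>\<^sup>+l. ennreal \<bar>real_of_int (y + rise l)\<bar> \<partial>measure_pmf (paths (Suc n)))"
    unfolding nn_integral_paths_Suc rise.simps add.assoc ..
  finally show ?case by simp
qed simp

lemma rise_first_moment:
  "(\<integral>\<^sup>+l. ennreal \<bar>real_of_int (rise l)\<bar> \<partial>measure_pmf (paths n))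
     \<le> ennreal (((1 - \<delta>) * nu_second + 1) / 2 * sqrt (real n))"
proof (cases "n = 0")
  case False
  let ?c = "(1 - \<delta>) * nu_second" and ?a = "sqrt (real n)"
  have a: "0 < ?a" "?a * ?a = real n" using False by auto
  have c: "0 \<le> ?c" using delta nu_second_nonneg by simp
  have eq: "(1 / (2 * t)) * ((t * t) * c) + t / 2 = (c + 1) / 2 * t" if "0 < t" for t c :: real
    using that by (simp add: field_simps)
  have "(\<integral>\<^sup>+l. ennreal \<bar>real_of_int (rise l)\<bar> \<partial>measure_pmf (paths n))
    \<le> (\<integral>\<^sup>+l. ennreal (1 / (2 * ?a)) * ennreal ((real_of_int (0 + rise l))\<^sup>2) + ennreal (?a / 2) \<partial>measure_pmf (paths n))"
    by (intro nn_integral_mono)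
       (use abs_le_quadratic[OF a(1)] a in \<open>auto simp flip: ennreal_mult ennreal_plus intro!: ennreal_leI\<close>)
  also have "\<dots> = ennreal (1 / (2 * ?a)) * ennreal (real n * ?c) + ennreal (?a / 2)"
    by (subst nn_integral_add, simp, simp, subst nn_integral_cmult, simp, subst rise_second_moment) simp
  also have "\<dots> = ennreal ((1 / (2 * ?a)) * (real n * ?c) + ?a / 2)"
    using a c by (simp flip: ennreal_mult ennreal_plus)
  also have "(1 / (2 * ?a)) * (real n * ?c) + ?a / 2 = (?c + 1) / 2 * ?a"
    using eq[OF a(1), of ?c] unfolding a(2) .
  finally show ?thesis .
qed simp

definition visit_const :: real where
  "visit_const = ((1 - \<delta>) * nu_second + 1) / 2 / tanaka_rate"

lemma visit_const_nonneg: "0 \<le> visit_const"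
  using delta nu_second_nonneg tanaka_rate_pos by (simp add: visit_const_def)

lemma mean_visits_le: "mean_visits n 0 \<le> ennreal (visit_const * sqrt (real n))"
proof -
  have "mean_visits n 0 = ennreal (1 / tanaka_rate) * (ennreal tanaka_rate * mean_visits n 0)"
    using tanaka_rate_pos by (simp add: mult.assoc[symmetric] flip: ennreal_mult)
  also have "ennreal tanaka_rate * mean_visits n 0 \<le> ennreal (((1 - \<delta>) * nu_second + 1) / 2 * sqrt (real n))"
    using tanaka_lower_bound[of 0 n] rise_first_moment[of n] by simp
  also have "ennreal (1 / tanaka_rate) * ennreal (((1 - \<delta>) * nu_second + 1) / 2 * sqrt (real n)) = ennreal (visit_const * sqrt (real n))"
    using tanaka_rate_pos nu_second_nonneg delta by (simp add: visit_const_def flip: ennreal_mult)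
  finally show ?thesis by (simp add: mult_left_mono)
qed

definition intersection_const :: real where
  "intersection_const = \<delta> * (1 + 2 * visit_const)"

lemma intersection_const_nonneg: "0 \<le> intersection_const"
  using delta visit_const_nonneg by (simp add: intersection_const_def)

text \<open>
  A step put in front of a path adds the visits of the path to the new starting height, and
  these are at most of order \<open>sqrt n\<close> in mean.
\<close>
lemma mean_self_intersections_le:
  "(\<integral>\<^sup>+l. ennreal (real (self_intersections (heights 0 l))) \<partial>measure_pmf (paths n))
     \<le> ennreal (intersection_const * (real n * sqrt (real n)))" (is "?I n \<le> _")
proof (induction n)
  case (Suc n)
  have shift: "self_intersections (heights (0 + x) l) = self_intersections (heights 0 l)" for x l
    using heights_shift[of x 0 l] self_intersections_shift by simp
  have cons: "ennreal (real (self_intersections (p # ps))) = ennreal (real (self_intersections ps)) + (ennreal 1 + ennreal 2 * ennreal (real (count_list ps p)))" for p ps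
    by (simp flip: ennreal_mult ennreal_plus del: ennreal_1 ennreal_numeral)
  have "?I (Suc n) = ennreal \<delta> * (\<integral>\<^sup>+l. ennreal (real (self_intersections (heights 0 l))) + (ennreal 1 + ennreal 2 * ennreal (real (count_list (heights 0 l) 0))) \<partial>measure_pmf (paths n))
     + ennreal (1 - \<delta>) * ?I n"
    unfolding nn_integral_paths_Suc heights.simps shift cons by simp
  also have "\<dots> = ennreal \<delta> * (?I n + (ennreal 1 + ennreal 2 * mean_visits n 0)) + ennreal (1 - \<delta>) * ?I n"
    by (subst nn_integral_add, simp, simp, subst nn_integral_add, simp, simp, subst nn_integral_cmult) auto
  also have "\<dots> = (ennreal \<delta> * ?I n + ennreal (1 - \<delta>) * ?I n) + ennreal \<delta> * (ennreal 1 + ennreal 2 * mean_visits n 0)"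
    by (simp only: distrib_left ac_simps)
  also have "\<dots> = ?I n + ennreal \<delta> * (ennreal 1 + ennreal 2 * mean_visits n 0)"
    by (simp only: ennreal_mixture_same)
  also have "\<dots> \<le> ennreal (intersection_const * (real n * sqrt (real n))) + ennreal \<delta> * (ennreal 1 + ennreal 2 * ennreal (visit_const * sqrt (real n)))"
    by (intro add_mono mult_left_mono Suc.IH mean_visits_le) auto
  also have "\<dots> = ennreal (intersection_const * (real n * sqrt (real n)) + \<delta> * (1 + 2 * (visit_const * sqrt (real n))))"
    using delta visit_const_nonneg intersection_const_nonneg
    by (simp flip: ennreal_mult ennreal_plus del: ennreal_1 ennreal_numeral)
  also have "\<dots> \<le> ennreal (intersection_const * (real (Suc n) * sqrt (real (Suc n))))"
  proof (rule ennreal_leI)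
    let ?s = "sqrt (real (Suc n))"
    have s: "sqrt (real n) \<le> ?s" "1 \<le> ?s" by auto
    have "\<delta> * (1 + 2 * (visit_const * sqrt (real n))) \<le> \<delta> * (?s + 2 * (visit_const * ?s))"
      using s delta visit_const_nonneg by (intro mult_left_mono add_mono) auto
    also have "\<dots> = intersection_const * ?s" by (simp add: intersection_const_def algebra_simps)
    finally have 1: "\<delta> * (1 + 2 * (visit_const * sqrt (real n))) \<le> intersection_const * ?s" .
    have "intersection_const * (real n * sqrt (real n)) \<le> intersection_const * (real n * ?s)"
      using s intersection_const_nonneg by (intro mult_left_mono) auto
    with 1 have "intersection_const * (real n * sqrt (real n)) + \<delta> * (1 + 2 * (visit_const * sqrt (real n)))
       \<le> intersection_const * (real n * ?s) + intersection_const * ?s" by linarith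
    also have "\<dots> = intersection_const * (real (Suc n) * ?s)" by (simp add: algebra_simps)
    finally show "intersection_const * (real n * sqrt (real n)) + \<delta> * (1 + 2 * (visit_const * sqrt (real n)))
       \<le> intersection_const * (real (Suc n) * ?s)" .
  qed
  finally show ?case .
qed simp

section \<open>Second moments of the displacement\<close>

lemma indep_coordinates_real: "scenery.indep_vars (\<lambda>_. borel) (\<lambda>p \<xi>. real_of_int (\<xi> p)) A"
  by (rule scenery.indep_vars_subset[OF scenery.indep_vars_compose2[OF indep_coordinates]]) auto

lemma integrable_coordinate_square: "integrable scenery (\<lambda>\<xi>. (real_of_int (\<xi> p))\<^sup>2)"
  using integrable_coordinate[of "\<lambda>x. (real_of_int x)\<^sup>2" p] mu_square by simp

lemma covariance:
  "integrable scenery (\<lambda>\<xi>. real_of_int (\<xi> a) * real_of_int (\<xi> b))"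
  "(\<integral>\<xi>. real_of_int (\<xi> a) * real_of_int (\<xi> b) \<partial>scenery) = (if a = b then mu_second else 0)"
proof -
  have i: "integrable scenery (\<lambda>\<xi>. real_of_int (\<xi> p))" for p
    using integrable_coordinate[of real_of_int p] integrable_mu by simp
  have z: "(\<integral>\<xi>. real_of_int (\<xi> p) \<partial>scenery) = 0" for p
    using integral_coordinate[of real_of_int p] mu_centered by simp
  have sq: "(\<integral>\<xi>. (real_of_int (\<xi> p))\<^sup>2 \<partial>scenery) = mu_second" for p
    using integral_coordinate[of "\<lambda>x. (real_of_int x)\<^sup>2" p] by (simp add: mu_second_def)
  have "integrable scenery (\<lambda>\<xi>. real_of_int (\<xi> a) * real_of_int (\<xi> b)) \<and>
    (\<integral>\<xi>. real_of_int (\<xi> a) * real_of_int (\<xi> b) \<partial>scenery) = (if a = b then mu_second else 0)"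
  proof (cases "a = b")
    case True
    then show ?thesis using integrable_coordinate_square[of b] sq[of b] by (simp add: power2_eq_square)
  next
    case False
    then show ?thesis
      using scenery.indep_vars_integrable[OF _ indep_coordinates_real[of "{a, b}"] i]
        scenery.indep_vars_lebesgue_integral[OF _ indep_coordinates_real[of "{a, b}"] i] z
      by simp
  qed
  then show "integrable scenery (\<lambda>\<xi>. real_of_int (\<xi> a) * real_of_int (\<xi> b))"
    "(\<integral>\<xi>. real_of_int (\<xi> a) * real_of_int (\<xi> b) \<partial>scenery) = (if a = b then mu_second else 0)" by auto
qed

lemma covariance_sum:
  "integrable scenery (\<lambda>\<xi>. real_of_int (\<xi> a) * real_of_int (sum_list (map \<xi> ps))) \<and>
   (\<integral>\<xi>. real_of_int (\<xi> a) * real_of_int (sum_list (map \<xi> ps)) \<partial>scenery) = mu_second * real (count_list ps a)"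
proof (induction ps)
  case (Cons p ps)
  have eq: "real_of_int (\<xi> a) * real_of_int (sum_list (map \<xi> (p # ps)))
    = real_of_int (\<xi> a) * real_of_int (\<xi> p) + real_of_int (\<xi> a) * real_of_int (sum_list (map \<xi> ps))" for \<xi>
    by (simp add: distrib_left)
  show ?case
    unfolding eq using Cons covariance(1)[of a p] by (simp add: covariance(2) distrib_left)
qed simp

lemma integrable_and_second_moment:
  "integrable scenery (\<lambda>\<xi>. (real_of_int (sum_list (map \<xi> ps)))\<^sup>2) \<and>
   (\<integral>\<xi>. (real_of_int (sum_list (map \<xi> ps)))\<^sup>2 \<partial>scenery) = mu_second * real (self_intersections ps)"
proof (induction ps)
  case (Cons p ps)
  have eq: "(real_of_int (sum_list (map \<xi> (p # ps))))\<^sup>2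
     = real_of_int (\<xi> p) * real_of_int (\<xi> p) + (2 * (real_of_int (\<xi> p) * real_of_int (sum_list (map \<xi> ps))) + (real_of_int (sum_list (map \<xi> ps)))\<^sup>2)" for \<xi>
    by (simp add: power2_eq_square algebra_simps)
  show ?case
    unfolding eq using Cons covariance[of p p] covariance_sum[of p ps] by (simp add: distrib_left)
qed simp

text \<open>
  Given the path, the variance of the displacement counts the coincidences of heights.
\<close>
lemma sum_second_moment:
  "(\<integral>\<^sup>+\<xi>. ennreal ((real_of_int (sum_list (map \<xi> ps)))\<^sup>2) \<partial>scenery) = ennreal (mu_second * real (self_intersections ps))"
  using integrable_and_second_moment[of ps] by (subst nn_integral_eq_integral) auto

definition displacement_const :: real where
  "displacement_const = mu_second * intersection_const"

lemma displacement_const_nonneg: "0 \<le> displacement_const"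
  using mu_second_nonneg intersection_const_nonneg by (simp add: displacement_const_def)

lemma displacement_second_moment:
  "(\<integral>\<^sup>+l. \<integral>\<^sup>+\<xi>. ennreal ((real_of_int (sum_list (map \<xi> (heights 0 l))))\<^sup>2) \<partial>scenery \<partial>measure_pmf (paths n))
    \<le> ennreal (displacement_const * (real n * sqrt (real n)))"
proof -
  have "(\<integral>\<^sup>+l. \<integral>\<^sup>+\<xi>. ennreal ((real_of_int (sum_list (map \<xi> (heights 0 l))))\<^sup>2) \<partial>scenery \<partial>measure_pmf (paths n))
    = ennreal mu_second * (\<integral>\<^sup>+l. ennreal (real (self_intersections (heights 0 l))) \<partial>measure_pmf (paths n))"
    unfolding sum_second_moment using mu_second_nonneg by (simp add: ennreal_mult nn_integral_cmult)
  also have "\<dots> \<le> ennreal mu_second * ennreal (intersection_const * (real n * sqrt (real n)))"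
    by (intro mult_left_mono mean_self_intersections_le) auto
  finally show ?thesis
    using mu_second_nonneg intersection_const_nonneg by (simp add: displacement_const_def mult.assoc flip: ennreal_mult)
qed

section \<open>The mean maximum from above\<close>

definition max_second_moment :: "nat \<Rightarrow> ennreal" where
  "max_second_moment n = (\<integral>\<^sup>+l. \<integral>\<^sup>+\<xi>. ennreal ((real_of_int (max_prefix_sum (map \<xi> (heights 0 l))))\<^sup>2) \<partial>scenery \<partial>measure_pmf (paths n))"

lemma quenched_max_append:
  "(\<integral>\<^sup>+\<xi>. ennreal ((real_of_int (max_prefix_sum (map \<xi> (heights 0 (l @ l')))))\<^sup>2) \<partial>scenery)
    \<le> ennreal 5 * (\<integral>\<^sup>+\<xi>. ennreal ((real_of_int (sum_list (map \<xi> (heights 0 l))))\<^sup>2) \<partial>scenery)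
      + ennreal (5/4) * ((\<integral>\<^sup>+\<xi>. ennreal ((real_of_int (max_prefix_sum (map \<xi> (heights 0 l))))\<^sup>2) \<partial>scenery)
          + (\<integral>\<^sup>+\<xi>. ennreal ((real_of_int (max_prefix_sum (map \<xi> (heights 0 l'))))\<^sup>2) \<partial>scenery))"
    (is "?L \<le> _")
proof -
  have m: "(\<lambda>\<xi>. ennreal ((real_of_int (f (map \<xi> ps)))\<^sup>2)) \<in> borel_measurable scenery" for f :: "int list \<Rightarrow> int" and ps
    by (rule sample_measurable) simp
  have "?L \<le> (\<integral>\<^sup>+\<xi>. ennreal 5 * ennreal ((real_of_int (sum_list (map \<xi> (heights 0 l))))\<^sup>2)
      + ennreal (5/4) * (ennreal ((real_of_int (max_prefix_sum (map \<xi> (heights 0 l))))\<^sup>2)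
          + ennreal ((real_of_int (max_prefix_sum (map \<xi> (heights (rise l) l'))))\<^sup>2)) \<partial>scenery)"
    using max_prefix_sum_append_square
    by (intro nn_integral_mono)
       (auto simp: heights_append intro!: ennreal_leI simp flip: ennreal_plus ennreal_mult simp del: ennreal_numeral)
  also have "\<dots> = ennreal 5 * (\<integral>\<^sup>+\<xi>. ennreal ((real_of_int (sum_list (map \<xi> (heights 0 l))))\<^sup>2) \<partial>scenery)
      + ennreal (5/4) * ((\<integral>\<^sup>+\<xi>. ennreal ((real_of_int (max_prefix_sum (map \<xi> (heights 0 l))))\<^sup>2) \<partial>scenery)
          + (\<integral>\<^sup>+\<xi>. ennreal ((real_of_int (max_prefix_sum (map \<xi> (heights (rise l) l'))))\<^sup>2) \<partial>scenery))"
    using m by (simp add: nn_integral_add nn_integral_cmult del: ennreal_numeral)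
  finally show ?thesis
    unfolding sample_heights[of "\<lambda>as. ennreal ((real_of_int (max_prefix_sum as))\<^sup>2)" "rise l" l'] .
qed

text \<open>
  The second half of the path sees a translated scenery, hence has a maximum with the same law as
  the first half.
\<close>
lemma max_second_moment_double:
  "max_second_moment (n + n) \<le> ennreal 5 * ennreal (displacement_const * (real n * sqrt (real n)))
     + ennreal (5/4) * (max_second_moment n + max_second_moment n)"
proof -
  let ?Z = "\<lambda>l. \<integral>\<^sup>+\<xi>. ennreal ((real_of_int (sum_list (map \<xi> (heights 0 l))))\<^sup>2) \<partial>scenery"
  let ?M = "\<lambda>l. \<integral>\<^sup>+\<xi>. ennreal ((real_of_int (max_prefix_sum (map \<xi> (heights 0 l))))\<^sup>2) \<partial>scenery"
  have "max_second_moment (n + n) \<le> (\<integral>\<^sup>+l. \<integral>\<^sup>+l'. ennreal 5 * ?Z l + ennreal (5/4) * (?M l + ?M l') \<partial>measure_pmf (paths n) \<partial>measure_pmf (paths n))"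
    unfolding max_second_moment_def nn_integral_paths_add
    by (intro nn_integral_mono quenched_max_append)
  also have "\<dots> = ennreal 5 * (\<integral>\<^sup>+l. ?Z l \<partial>measure_pmf (paths n)) + ennreal (5/4) * (max_second_moment n + max_second_moment n)"
    by (simp add: nn_integral_add nn_integral_cmult max_second_moment_def del: ennreal_numeral)
  also have "\<dots> \<le> ennreal 5 * ennreal (displacement_const * (real n * sqrt (real n))) + ennreal (5/4) * (max_second_moment n + max_second_moment n)"
    by (intro add_mono mult_left_mono displacement_second_moment) auto
  finally show ?thesis .
qed

text \<open>
  The factor \<open>20\<close> suffices because \<open>20 (2.82 - 2.5)\<close> exceeds the \<open>5\<close> of the recursion; the second
  moment of a single site starts the induction.
\<close>
definition max_const :: real where
  "max_const = 20 * displacement_const + mu_second"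

lemma max_const_nonneg: "0 \<le> max_const"
  using displacement_const_nonneg mu_second_nonneg by (simp add: max_const_def)

lemma max_second_moment_one: "max_second_moment 1 \<le> ennreal mu_second"
proof -
  have le: "(\<integral>\<^sup>+\<xi>. ennreal ((real_of_int (max_prefix_sum (map \<xi> (heights 0 l))))\<^sup>2) \<partial>scenery) \<le> ennreal mu_second"
    if "l \<in> set_pmf (paths 1)" for l
  proof -
    from that obtain s where l: "l = [s]"
      by (auto simp: replicate_pmf_1)
    have "(\<integral>\<^sup>+\<xi>. ennreal ((real_of_int (max_prefix_sum (map \<xi> (heights 0 l))))\<^sup>2) \<partial>scenery)
       \<le> (\<integral>\<^sup>+\<xi>. ennreal ((real_of_int (sum_list (map \<xi> (heights 0 l))))\<^sup>2) \<partial>scenery)"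
      unfolding l by (cases s) (auto intro!: nn_integral_mono ennreal_leI simp: max_def)
    also have "\<dots> \<le> ennreal mu_second"
      unfolding sum_second_moment l using mu_second_nonneg by (cases s) (auto intro!: ennreal_leI)
    finally show ?thesis .
  qed
  have "max_second_moment 1 \<le> (\<integral>\<^sup>+l. ennreal mu_second \<partial>measure_pmf (paths 1))"
    unfolding max_second_moment_def
    by (rule nn_integral_mono_AE) (use le in \<open>auto simp: AE_measure_pmf_iff\<close>)
  then show ?thesis by simp
qed

lemma max_second_moment_power:
  "max_second_moment (2 ^ j) \<le> ennreal (max_const * (2 ^ j * sqrt (2 ^ j)))"
proof (induction j)
  case 0
  have "max_second_moment 1 \<le> ennreal mu_second" by (rule max_second_moment_one)
  also have "\<dots> \<le> ennreal max_const"
    using displacement_const_nonneg by (intro ennreal_leI) (simp add: max_const_def)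
  finally show ?case by simp
next
  case (Suc j)
  let ?x = "2 ^ j * sqrt (2 ^ j) :: real"
  have "max_second_moment (2 ^ Suc j) = max_second_moment (2 ^ j + 2 ^ j)"
    by (simp add: mult_2)
  also have "\<dots> \<le> ennreal 5 * ennreal (displacement_const * ?x) + ennreal (5/4) * (max_second_moment (2 ^ j) + max_second_moment (2 ^ j))"
    using max_second_moment_double[of "2 ^ j"] by simp
  also have "\<dots> \<le> ennreal 5 * ennreal (displacement_const * ?x) + ennreal (5/4) * (ennreal (max_const * ?x) + ennreal (max_const * ?x))"
    by (intro add_mono mult_left_mono Suc.IH) auto
  also have "\<dots> = ennreal (5 * (displacement_const * ?x) + 5/4 * (max_const * ?x + max_const * ?x))"
    using displacement_const_nonneg max_const_nonneg by (simp flip: ennreal_plus ennreal_mult del: ennreal_numeral)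
  also have "\<dots> \<le> ennreal (max_const * (2 ^ Suc j * sqrt (2 ^ Suc j)))"
  proof (rule ennreal_leI)
    have "(141/100)\<^sup>2 \<le> (2::real)" by (simp add: power2_eq_square)
    then have s: "141/100 \<le> sqrt (2::real)" by (rule real_le_rsqrt)
    have "5 * displacement_const + 5/2 * max_const \<le> max_const * (282/100)"
      using displacement_const_nonneg mu_second_nonneg by (simp add: max_const_def)
    also have "\<dots> \<le> max_const * (2 * sqrt 2)"
      using s max_const_nonneg by (intro mult_left_mono) auto
    finally have "(5 * displacement_const + 5/2 * max_const) * ?x \<le> (max_const * (2 * sqrt 2)) * ?x"
      by (rule mult_right_mono) simp
    then show "5 * (displacement_const * ?x) + 5/4 * (max_const * ?x + max_const * ?x) \<le> max_const * (2 ^ Suc j * sqrt (2 ^ Suc j))"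
      by (simp add: real_sqrt_mult algebra_simps)
  qed
  finally show ?case .
qed

lemma mean_max_power:
  "mean_max (2 ^ j) \<le> ennreal ((max_const + 1) / 2 * sqrt (2 ^ j * sqrt (2 ^ j)))"
proof -
  let ?a = "sqrt (2 ^ j * sqrt (2 ^ j)) :: real"
  have a: "0 < ?a" "?a * ?a = 2 ^ j * sqrt (2 ^ j)" by auto
  have eq: "(1 / (2 * t)) * (max_const * (t * t)) + t / 2 = (max_const + 1) / 2 * t" if "0 < t" for t
    using that by (simp add: field_simps)
  have "mean_max (2 ^ j) \<le> (\<integral>\<^sup>+l. \<integral>\<^sup>+\<xi>. ennreal (1 / (2 * ?a)) * ennreal ((real_of_int (max_prefix_sum (map \<xi> (heights 0 l))))\<^sup>2) + ennreal (?a / 2) \<partial>scenery \<partial>measure_pmf (paths (2 ^ j)))"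
    unfolding mean_max_def
  proof (intro nn_integral_mono)
    fix l \<xi>
    let ?m = "real_of_int (max_prefix_sum (map \<xi> (heights 0 l)))"
    have "ennreal ?m \<le> ennreal ((1 / (2 * ?a)) * ?m\<^sup>2 + ?a / 2)"
      using abs_le_quadratic[OF a(1), of ?m] by (intro ennreal_leI) linarith
    then show "ennreal ?m \<le> ennreal (1 / (2 * ?a)) * ennreal (?m\<^sup>2) + ennreal (?a / 2)"
      using a(1) by (simp flip: ennreal_mult ennreal_plus)
  qed
  also have "\<dots> = ennreal (1 / (2 * ?a)) * max_second_moment (2 ^ j) + ennreal (?a / 2)"
    unfolding max_second_moment_def
    by (simp add: nn_integral_add nn_integral_cmult sample_measurable scenery.emeasure_space_1[unfolded space_scenery])
  also have "\<dots> \<le> ennreal (1 / (2 * ?a)) * ennreal (max_const * (2 ^ j * sqrt (2 ^ j))) + ennreal (?a / 2)"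
    by (intro add_mono mult_left_mono max_second_moment_power) auto
  also have "\<dots> = ennreal ((1 / (2 * ?a)) * (max_const * (?a * ?a)) + ?a / 2)"
    unfolding a(2) using a(1) max_const_nonneg by (simp flip: ennreal_mult ennreal_plus)
  also have "(1 / (2 * ?a)) * (max_const * (?a * ?a)) + ?a / 2 = (max_const + 1) / 2 * ?a"
    by (rule eq[OF a(1)])
  finally show ?thesis .
qed

lemma mean_max_le:
  "mean_max n \<le> ennreal ((max_const + 1) * sqrt (real n * sqrt (real n)))"
proof (cases "n = 0")
  case True
  then show ?thesis by (simp add: mean_max_def)
next
  case False
  \<comment> \<open>Monotonicity extends the bound from powers of two, at the price of a factor \<open>sqrt (2 sqrt 2) \<le> 2\<close>.\<close>
  obtain j where j: "2 ^ j \<le> n" "n < 2 ^ (j + 1)"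
    using ex_power_ivl1[of 2 n] False by auto
  have "mean_max n \<le> mean_max (2 ^ (j + 1))"
    using mean_max_mono[of n "2 ^ (j + 1) - n"] j by simp
  also have "\<dots> \<le> ennreal ((max_const + 1) / 2 * sqrt (2 ^ (j + 1) * sqrt (2 ^ (j + 1))))"
    by (rule mean_max_power)
  also have "\<dots> \<le> ennreal ((max_const + 1) / 2 * (2 * sqrt (real n * sqrt (real n))))"
  proof (intro ennreal_leI mult_left_mono)
    have le: "(2 ^ (j + 1) :: real) \<le> 2 * real n"
      using of_nat_mono[OF j(1), where 'a=real] by simp
    have "(2::real) ^ (j + 1) * sqrt (2 ^ (j + 1)) \<le> (2 * real n) * sqrt (2 * real n)"
      using le by (intro mult_mono real_sqrt_le_mono) auto
    also have "\<dots> = (2 * sqrt 2) * (real n * sqrt (real n))"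
      by (simp add: real_sqrt_mult)
    also have "\<dots> \<le> 4 * (real n * sqrt (real n))"
    proof (rule mult_right_mono)
      show "2 * sqrt 2 \<le> (4::real)" using real_sqrt_le_mono[of 2 4] by simp
    qed simp
    finally have "sqrt (2 ^ (j + 1) * sqrt (2 ^ (j + 1))) \<le> sqrt (4 * (real n * sqrt (real n)))"
      by (rule real_sqrt_le_mono)
    also have "\<dots> = 2 * sqrt (real n * sqrt (real n))"
      by (simp add: real_sqrt_mult)
    finally show "sqrt (2 ^ (j + 1) * sqrt (2 ^ (j + 1))) \<le> 2 * sqrt (real n * sqrt (real n))" .
  qed (use max_const_nonneg in auto)
  finally show ?thesis by simp
qed

section \<open>The mean maximum from below\<close>

text \<open>
  By symmetry the two atoms at \<open>v\<close> and \<open>- v\<close> contribute a cosine; the remaining mass is bounded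
  trivially.
\<close>
lemma char_atom_bound:
  assumes "0 < v"
  shows "cmod (CLINT x|measure_pmf \<mu>. iexp (s * real_of_int x)) \<le> 1 - 2 * pmf \<mu> v * (1 - \<bar>cos (s * real_of_int v)\<bar>)"
proof -
  let ?A = "{v, - v}"
  let ?f = "\<lambda>x::int. iexp (s * real_of_int x)"
  let ?g = "\<lambda>x. indicator (- ?A) x *\<^sub>R ?f x" and ?h = "\<lambda>x. indicator ?A x *\<^sub>R ?f x"
  have p: "pmf \<mu> (- v) = pmf \<mu> v"
    using pmf_map_inj'[of uminus \<mu> v] by (simp add: mu_symmetric)
  have ig: "integrable (measure_pmf \<mu>) ?g" "integrable (measure_pmf \<mu>) ?h"
    by (auto intro!: measure_pmf.integrable_const_bound[where B=1] simp: indicator_def)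
  have "(CLINT x|measure_pmf \<mu>. ?f x) = (CLINT x|measure_pmf \<mu>. ?g x + ?h x)"
    by (intro Bochner_Integration.integral_cong) (auto simp: indicator_def)
  also have "\<dots> = (CLINT x|measure_pmf \<mu>. ?g x) + (CLINT x|measure_pmf \<mu>. ?h x)"
    using ig by simp
  finally have split: "(CLINT x|measure_pmf \<mu>. ?f x) = (CLINT x|measure_pmf \<mu>. ?g x) + (CLINT x|measure_pmf \<mu>. ?h x)" .
  have "(CLINT x|measure_pmf \<mu>. ?h x) = (\<Sum>a\<in>?A. pmf \<mu> a *\<^sub>R ?h a)"
    by (rule integral_measure_pmf) (auto simp: indicator_def)
  also have "\<dots> = of_real (pmf \<mu> v) * (?f v + ?f (- v))"
    using assms p by (simp add: scaleR_conv_of_real algebra_simps)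
  also have "?f v + ?f (- v) = of_real (2 * cos (s * real_of_int v))"
    by (simp add: complex_eq_iff Re_exp Im_exp)
  finally have h: "cmod (CLINT x|measure_pmf \<mu>. ?h x) = 2 * pmf \<mu> v * \<bar>cos (s * real_of_int v)\<bar>"
    by (simp add: norm_mult abs_mult del: of_real_mult)
  have "cmod (CLINT x|measure_pmf \<mu>. ?g x) \<le> (LINT x|measure_pmf \<mu>. cmod (?g x))"
    by (rule integral_norm_bound)
  also have "(LINT x|measure_pmf \<mu>. cmod (?g x)) = (LINT x|measure_pmf \<mu>. indicator (- ?A) x)"
    by (intro Bochner_Integration.integral_cong) (auto simp: indicator_def)
  also have "\<dots> = measure_pmf.prob \<mu> (- ?A)" by simp
  also have "\<dots> = 1 - measure_pmf.prob \<mu> ?A"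
    by (subst measure_pmf.prob_compl[symmetric]) (auto simp: Compl_eq_Diff_UNIV)
  also have "measure_pmf.prob \<mu> ?A = 2 * pmf \<mu> v"
    using assms p by (subst measure_measure_pmf_finite) auto
  finally have g: "cmod (CLINT x|measure_pmf \<mu>. ?g x) \<le> 1 - 2 * pmf \<mu> v" .
  show ?thesis
    unfolding split using norm_triangle_ineq[of "CLINT x|measure_pmf \<mu>. ?g x" "CLINT x|measure_pmf \<mu>. ?h x"] g h
    by (simp add: algebra_simps)
qed

lemma char_gaussian_bound:
  assumes "0 < v" "\<bar>s * real_of_int v\<bar> \<le> 1"
  shows "cmod (CLINT x|measure_pmf \<mu>. iexp (s * real_of_int x)) \<le> exp (- (pmf \<mu> v / 2) * (s * real_of_int v)\<^sup>2)"
proof -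
  let ?x = "s * real_of_int v"
  have "0 \<le> cos ?x"
  proof (rule cos_ge_zero)
    show "- (pi / 2) \<le> ?x" "?x \<le> pi / 2" using assms(2) pi_gt3 by auto
  qed
  then have "\<bar>cos ?x\<bar> \<le> 1 - ?x\<^sup>2 / 4" using cos_le_quadratic[OF assms(2)] by simp
  then have "2 * pmf \<mu> v * (?x\<^sup>2 / 4) \<le> 2 * pmf \<mu> v * (1 - \<bar>cos ?x\<bar>)"
    by (intro mult_left_mono) (auto simp: pmf_nonneg)
  then have "cmod (CLINT x|measure_pmf \<mu>. iexp (s * real_of_int x)) \<le> 1 + (- (pmf \<mu> v / 2) * ?x\<^sup>2)"
    using char_atom_bound[OF assms(1), of s] by simp
  also have "\<dots> \<le> exp (- (pmf \<mu> v / 2) * ?x\<^sup>2)" by (rule exp_ge_add_one_self)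
  finally show ?thesis .
qed

lemma expectation_cos_le:
  "(\<integral>\<xi>. cos (t * real_of_int (sum_list (map \<xi> ps))) \<partial>scenery)
     \<le> (\<Prod>y\<in>set ps. cmod (CLINT x|measure_pmf \<mu>. iexp (t * real (count_list ps y) * real_of_int x)))"
proof -
  let ?Y = "\<lambda>y \<xi>. real (count_list ps y) * real_of_int (\<xi> y)"
  let ?W = "\<lambda>\<xi>. \<Sum>y\<in>set ps. ?Y y \<xi>"
  have W: "real_of_int (sum_list (map \<xi> ps)) = ?W \<xi>" for \<xi>
    by (rule sum_list_eq_occupation_sum) auto
  have Ym: "?Y y \<in> borel_measurable scenery" for y
    by (intro borel_measurable_times borel_measurable_const coordinate_measurable) simp
  have Wm: "?W \<in> borel_measurable scenery"
    by (intro borel_measurable_sum Ym)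
  have ind: "scenery.indep_vars (\<lambda>_. borel) ?Y (set ps)"
    by (rule scenery.indep_vars_compose2[OF indep_coordinates_real]) auto
  have "(CLINT \<xi>|scenery. iexp (t * ?W \<xi>)) = char (distr scenery borel ?W) t"
    unfolding char_def using Wm by (subst integral_distr) auto
  also have "\<dots> = (\<Prod>y\<in>set ps. char (distr scenery borel (?Y y)) t)"
    by (rule scenery.char_distr_sum[OF ind])
  also have "\<dots> = (\<Prod>y\<in>set ps. CLINT x|measure_pmf \<mu>. iexp (t * real (count_list ps y) * real_of_int x))"
  proof (intro prod.cong refl)
    fix y
    have "char (distr scenery borel (?Y y)) t = (CLINT \<xi>|scenery. iexp (t * ?Y y \<xi>))"
      unfolding char_def using Ym by (subst integral_distr) auto
    also have "\<dots> = (CLINT x|distr scenery (measure_pmf \<mu>) (\<lambda>\<xi>. \<xi> y). iexp (t * (real (count_list ps y) * real_of_int x)))"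
      by (subst integral_distr) (auto intro: coordinate_measurable)
    finally show "char (distr scenery borel (?Y y)) t = (CLINT x|measure_pmf \<mu>. iexp (t * real (count_list ps y) * real_of_int x))"
      by (simp add: distr_coordinate mult.assoc)
  qed
  finally have prod: "(CLINT \<xi>|scenery. iexp (t * ?W \<xi>)) = \<dots>" .
  have int: "integrable scenery (\<lambda>\<xi>. iexp (t * ?W \<xi>))"
    using Wm by (intro scenery.integrable_const_bound[of _ 1]) auto
  have "(\<integral>\<xi>. cos (t * ?W \<xi>) \<partial>scenery) = (\<integral>\<xi>. Re (iexp (t * ?W \<xi>)) \<partial>scenery)"
    by (simp add: Re_exp)
  also have "\<dots> = Re (CLINT \<xi>|scenery. iexp (t * ?W \<xi>))"
    by (rule integral_Re[OF int])
  also have "\<dots> \<le> cmod (CLINT \<xi>|scenery. iexp (t * ?W \<xi>))" by (rule complex_Re_le_cmod)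
  also have "\<dots> = (\<Prod>y\<in>set ps. cmod (CLINT x|measure_pmf \<mu>. iexp (t * real (count_list ps y) * real_of_int x)))"
    unfolding prod by (rule prod_norm[symmetric])
  finally show ?thesis unfolding W .
qed

lemma integrable_sum: "integrable scenery (\<lambda>\<xi>. real_of_int (sum_list (map \<xi> ps)))"
  and expectation_sum: "(\<integral>\<xi>. real_of_int (sum_list (map \<xi> ps)) \<partial>scenery) = 0"
proof -
  have i: "integrable scenery (\<lambda>\<xi>. real_of_int (\<xi> p))" for p
    using integrable_coordinate[of real_of_int p] integrable_mu by simp
  have z: "(\<integral>\<xi>. real_of_int (\<xi> p) \<partial>scenery) = 0" for p
    using integral_coordinate[of real_of_int p] mu_centered by simp
  have "integrable scenery (\<lambda>\<xi>. real_of_int (sum_list (map \<xi> ps))) \<and> (\<integral>\<xi>. real_of_int (sum_list (map \<xi> ps)) \<partial>scenery) = 0"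
    by (induction ps) (use i z in auto)
  then show "integrable scenery (\<lambda>\<xi>. real_of_int (sum_list (map \<xi> ps)))"
    "(\<integral>\<xi>. real_of_int (sum_list (map \<xi> ps)) \<partial>scenery) = 0" by auto
qed

text \<open>
  One has \<open>1 - cos (t W) \<le> t \<bar>W\<bar>\<close>, and the characteristic function of a sum of
  independent terms is a product, each factor being at most a Gaussian one. At the scale \<open>t\<close> of the inverse standard deviation it is bounded away from
  \<open>1\<close>.
\<close>
lemma sum_first_moment_ge:
  assumes v: "0 < v"
  shows "real_of_int v * (1 - exp (- (pmf \<mu> v / 2))) * sqrt (occupation ps)
     \<le> (\<integral>\<xi>. \<bar>real_of_int (sum_list (map \<xi> ps))\<bar> \<partial>scenery)"
proof (cases "ps = []")
  case True
  then show ?thesis by (simp add: occupation_def)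
next
  case False
  let ?V = "occupation ps"
  let ?W = "\<lambda>\<xi>. real_of_int (sum_list (map \<xi> ps))"
  define t where "t = 1 / (real_of_int v * sqrt ?V)"
  have V: "0 < ?V" using occupation_pos[OF False] .
  have t: "0 < t" using V v by (simp add: t_def)
  have tv: "t * c * real_of_int v = c / sqrt ?V" for c
    using v by (simp add: t_def)
  \<comment> \<open>No height takes more than the whole occupation, so the quadratic bound on the cosine applies to every factor.\<close>
  have le: "real (count_list ps y) \<le> sqrt ?V" if "y \<in> set ps" for y
  proof (rule real_le_rsqrt)
    show "(real (count_list ps y))\<^sup>2 \<le> ?V"
      unfolding occupation_def using that
      by (intro member_le_sum[where f="\<lambda>y. (real (count_list ps y))\<^sup>2"]) auto
  qed
  have "(\<integral>\<xi>. cos (t * ?W \<xi>) \<partial>scenery) \<le> (\<Prod>y\<in>set ps. cmod (CLINT x|measure_pmf \<mu>. iexp (t * real (count_list ps y) * real_of_int x)))"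
    by (rule expectation_cos_le)
  also have "\<dots> \<le> (\<Prod>y\<in>set ps. exp (- (pmf \<mu> v / 2) * (t * real (count_list ps y) * real_of_int v)\<^sup>2))"
    using le V v by (intro prod_mono conjI norm_ge_zero char_gaussian_bound) (auto simp: tv)
  also have "\<dots> = exp (\<Sum>y\<in>set ps. - (pmf \<mu> v / 2) * (t * real (count_list ps y) * real_of_int v)\<^sup>2)"
    by (simp add: exp_sum)
  also have "(\<Sum>y\<in>set ps. - (pmf \<mu> v / 2) * (t * real (count_list ps y) * real_of_int v)\<^sup>2) = - (pmf \<mu> v / 2) * (?V / ?V)"
    using V by (simp add: tv power_divide occupation_def sum_distrib_left[symmetric] sum_divide_distrib[symmetric] sum_negf del: divide_self_if)
  finally have cos: "(\<integral>\<xi>. cos (t * ?W \<xi>) \<partial>scenery) \<le> exp (- (pmf \<mu> v / 2))" using V by simp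
  have Wm: "?W \<in> borel_measurable scenery" by (rule sample_measurable) simp
  have ic: "integrable scenery (\<lambda>\<xi>. cos (t * ?W \<xi>))"
    using Wm by (intro scenery.integrable_const_bound[of _ 1]) auto
  have "(\<integral>\<xi>. 1 - cos (t * ?W \<xi>) \<partial>scenery) \<le> (\<integral>\<xi>. t * \<bar>?W \<xi>\<bar> \<partial>scenery)"
  proof (rule integral_mono)
    fix \<xi>
    show "1 - cos (t * ?W \<xi>) \<le> t * \<bar>?W \<xi>\<bar>"
      using one_minus_cos_le_abs[of "t * ?W \<xi>"] t by (simp add: abs_mult)
  qed (use ic integrable_sum[of ps] in auto)
  then have "1 - exp (- (pmf \<mu> v / 2)) \<le> t * (\<integral>\<xi>. \<bar>?W \<xi>\<bar> \<partial>scenery)"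
    using ic cos scenery.prob_space by simp
  then have "(1 - exp (- (pmf \<mu> v / 2))) / t \<le> (\<integral>\<xi>. \<bar>?W \<xi>\<bar> \<partial>scenery)"
    using t by (simp add: field_simps)
  then show ?thesis by (simp add: t_def ac_simps)
qed

lemma mean_length:
  "(\<integral>\<^sup>+l. ennreal (real (length (heights y l))) \<partial>measure_pmf (paths n)) = ennreal (\<delta> * real n)"
proof (induction n arbitrary: y)
  case (Suc n)
  have "(\<integral>\<^sup>+l. ennreal (real (length (heights y l))) \<partial>measure_pmf (paths (Suc n)))
    = ennreal \<delta> * (\<integral>\<^sup>+l. ennreal 1 + ennreal (real (length (heights y l))) \<partial>measure_pmf (paths n)) + ennreal (1 - \<delta>) * ennreal (\<delta> * real n)"
    unfolding nn_integral_paths_Suc heights.simps Suc.IH by (simp flip: ennreal_plus del: ennreal_1)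
  also have "\<dots> = ennreal \<delta> * (ennreal 1 + ennreal (\<delta> * real n)) + ennreal (1 - \<delta>) * ennreal (\<delta> * real n)"
    by (subst nn_integral_add) (auto simp: Suc.IH)
  also have "\<dots> = ennreal (\<delta> * (1 + \<delta> * real n) + (1 - \<delta>) * (\<delta> * real n))"
    using delta by (simp flip: ennreal_plus ennreal_mult del: ennreal_1)
  finally show ?case by (simp add: algebra_simps)
qed simp

text \<open>
  Chebyshev's inequality at each time, summed over the horizontal steps.
\<close>
lemma mean_far_length:
  assumes R: "0 < R"
  shows "(\<integral>\<^sup>+l. ennreal (real (length (filter (\<lambda>p. R < \<bar>real_of_int p\<bar>) (heights y l)))) \<partial>measure_pmf (paths n))
     \<le> ennreal (real n * ((real_of_int y)\<^sup>2 + real n * ((1 - \<delta>) * nu_second)) / R\<^sup>2)"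
proof (induction n arbitrary: y)
  case (Suc n)
  let ?c = "(1 - \<delta>) * nu_second"
  let ?F = "\<lambda>y l. ennreal (real (length (filter (\<lambda>p. R < \<bar>real_of_int p\<bar>) (heights y l))))"
  let ?k = "(real n + 1) * ?c"
  have c: "0 \<le> ?c" using delta nu_second_nonneg by simp
  have pt: "ennreal (real n * (z\<^sup>2 + k) / R\<^sup>2) = ennreal (real n / R\<^sup>2) * ennreal (z\<^sup>2 + k)" if "0 \<le> k" for z k :: real
    using that by (subst ennreal_mult[symmetric]) auto
  have cons: "?F y (None # l) \<le> ennreal ((real_of_int y)\<^sup>2 / R\<^sup>2) + ?F y l" for l
  proof (cases "R < \<bar>real_of_int y\<bar>")
    case True
    then have "R\<^sup>2 \<le> (real_of_int y)\<^sup>2" using R power_mono[of R "\<bar>real_of_int y\<bar>" 2] by simp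
    then have "1 \<le> (real_of_int y)\<^sup>2 / R\<^sup>2" using R by simp
    then show ?thesis using True by (auto intro!: ennreal_leI simp flip: ennreal_plus)
  qed simp
  have "(\<integral>\<^sup>+l. ?F y l \<partial>measure_pmf (paths (Suc n)))
     \<le> ennreal \<delta> * (\<integral>\<^sup>+l. ennreal ((real_of_int y)\<^sup>2 / R\<^sup>2) + ?F y l \<partial>measure_pmf (paths n))
      + ennreal (1 - \<delta>) * (\<integral>\<^sup>+x. \<integral>\<^sup>+l. ?F (y + x) l \<partial>measure_pmf (paths n) \<partial>measure_pmf \<nu>)"
    unfolding nn_integral_paths_Suc
    using cons by (intro add_mono mult_left_mono nn_integral_mono) auto
  also have "\<dots> \<le> ennreal \<delta> * (ennreal ((real_of_int y)\<^sup>2 / R\<^sup>2) + ennreal (real n * ((real_of_int y)\<^sup>2 + real n * ?c) / R\<^sup>2))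
      + ennreal (1 - \<delta>) * (\<integral>\<^sup>+x. ennreal (real n * ((real_of_int (y + x))\<^sup>2 + real n * ?c) / R\<^sup>2) \<partial>measure_pmf \<nu>)"
    using Suc.IH by (intro add_mono mult_left_mono nn_integral_mono) (auto simp: nn_integral_add simp del: of_int_add)
  also have "(\<integral>\<^sup>+x. ennreal (real n * ((real_of_int (y + x))\<^sup>2 + real n * ?c) / R\<^sup>2) \<partial>measure_pmf \<nu>)
     = ennreal (real n / R\<^sup>2) * (\<integral>\<^sup>+x. ennreal ((real_of_int (y + x))\<^sup>2 + real n * ?c) \<partial>measure_pmf \<nu>)"
    using c by (subst nn_integral_cmult[symmetric]) (simp_all only: pt mult_nonneg_nonneg of_nat_0_le_iff measurable_count_space_eq1 space_count_space, auto)
  also have "\<dots> = ennreal (real n * ((real_of_int y)\<^sup>2 + nu_second + real n * ?c) / R\<^sup>2)"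
    using c nu_second_nonneg
    by (subst nn_integral_nu_square, simp, subst ennreal_mult[symmetric]) (auto simp del: ennreal_plus)
  also have "ennreal \<delta> * (ennreal ((real_of_int y)\<^sup>2 / R\<^sup>2) + ennreal (real n * ((real_of_int y)\<^sup>2 + real n * ?c) / R\<^sup>2))
      + ennreal (1 - \<delta>) * ennreal (real n * ((real_of_int y)\<^sup>2 + nu_second + real n * ?c) / R\<^sup>2)
    = ennreal (\<delta> * ((real_of_int y)\<^sup>2 / R\<^sup>2 + real n * ((real_of_int y)\<^sup>2 + real n * ?c) / R\<^sup>2)
      + (1 - \<delta>) * (real n * ((real_of_int y)\<^sup>2 + nu_second + real n * ?c) / R\<^sup>2))"
    using c nu_second_nonneg
    by (subst ennreal_plus[symmetric], simp, simp, intro ennreal_mixture) auto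
  also have "\<dots> \<le> ennreal (real (Suc n) * ((real_of_int y)\<^sup>2 + real (Suc n) * ?c) / R\<^sup>2)"
  proof (rule ennreal_leI)
    have eq: "\<delta> * (a / r + b / r) + (1 - \<delta>) * (d / r) = (\<delta> * (a + b) + (1 - \<delta>) * d) / r" for a b d r
      by (simp add: add_divide_distrib distrib_left)
    have "\<delta> * (real_of_int y)\<^sup>2 \<le> 1 * (real_of_int y)\<^sup>2" using delta by (intro mult_right_mono) auto
    then have "\<delta> * ((real_of_int y)\<^sup>2 + real n * ((real_of_int y)\<^sup>2 + real n * ?c)) + (1 - \<delta>) * (real n * ((real_of_int y)\<^sup>2 + nu_second + real n * ?c))
       \<le> real (Suc n) * ((real_of_int y)\<^sup>2 + real (Suc n) * ?c)"
      using c mult_nonneg_nonneg[OF of_nat_0_le_iff[of n] c] by (simp add: algebra_simps)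
    then have "(\<delta> * ((real_of_int y)\<^sup>2 + real n * ((real_of_int y)\<^sup>2 + real n * ?c)) + (1 - \<delta>) * (real n * ((real_of_int y)\<^sup>2 + nu_second + real n * ?c))) / R\<^sup>2
       \<le> real (Suc n) * ((real_of_int y)\<^sup>2 + real (Suc n) * ?c) / R\<^sup>2"
      by (rule divide_right_mono) simp
    then show "\<delta> * ((real_of_int y)\<^sup>2 / R\<^sup>2 + real n * ((real_of_int y)\<^sup>2 + real n * ?c) / R\<^sup>2)
      + (1 - \<delta>) * (real n * ((real_of_int y)\<^sup>2 + nu_second + real n * ?c) / R\<^sup>2)
      \<le> real (Suc n) * ((real_of_int y)\<^sup>2 + real (Suc n) * ?c) / R\<^sup>2"
      unfolding eq .
  qed
  finally show ?case .
qed simp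

text \<open>
  Once \<open>R\<^sup>2\<close> is a large multiple of the variance of the height, at least half of the horizontal steps, in
  mean, are made at heights within \<open>R\<close>.
\<close>
lemma mean_near_length:
  assumes R: "0 < R" and c: "2 * real n * ((1 - \<delta>) * nu_second) \<le> \<delta> * (real R)\<^sup>2"
  shows "ennreal (\<delta> * real n / 2) \<le> (\<integral>\<^sup>+l. ennreal (real (length (filter (\<lambda>p. \<bar>real_of_int p\<bar> \<le> real R) (heights 0 l)))) \<partial>measure_pmf (paths n))"
    (is "_ \<le> ?N")
proof -
  let ?F = "\<integral>\<^sup>+l. ennreal (real (length (filter (\<lambda>p. real R < \<bar>real_of_int p\<bar>) (heights 0 l)))) \<partial>measure_pmf (paths n)"
  have split: "ennreal (real (length ps)) = ennreal (real (length (filter (\<lambda>p. \<bar>real_of_int p\<bar> \<le> real R) ps)))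
      + ennreal (real (length (filter (\<lambda>p. real R < \<bar>real_of_int p\<bar>) ps)))" for ps
    by (induction ps) (auto simp flip: ennreal_plus)
  have "ennreal (\<delta> * real n / 2) + ennreal (\<delta> * real n / 2) = ennreal (\<delta> * real n)"
    using delta by (simp flip: ennreal_plus)
  also have "\<dots> = (\<integral>\<^sup>+l. ennreal (real (length (heights 0 l))) \<partial>measure_pmf (paths n))"
    by (rule mean_length[symmetric])
  also have "\<dots> = ?N + ?F"
    by (subst nn_integral_add[symmetric], simp, simp) (intro nn_integral_cong split)
  also have "?F \<le> ennreal (\<delta> * real n / 2)"
  proof -
    have "?F \<le> ennreal (real n * ((real_of_int 0)\<^sup>2 + real n * ((1 - \<delta>) * nu_second)) / (real R)\<^sup>2)"
      using R by (intro mean_far_length) simp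
    also have "\<dots> \<le> ennreal (\<delta> * real n / 2)"
    proof (rule ennreal_leI)
      have "real n * (2 * real n * ((1 - \<delta>) * nu_second)) \<le> real n * (\<delta> * (real R)\<^sup>2)"
        using c by (intro mult_left_mono) auto
      then show "real n * ((real_of_int 0)\<^sup>2 + real n * ((1 - \<delta>) * nu_second)) / (real R)\<^sup>2 \<le> \<delta> * real n / 2"
        using R by (simp add: field_simps)
    qed
    finally show ?thesis .
  qed
  finally have "ennreal (\<delta> * real n / 2) + ennreal (\<delta> * real n / 2) \<le> ennreal (\<delta> * real n / 2) + ?N"
    by (simp add: add.commute add_mono)
  then show ?thesis by (simp add: ennreal_add_left_cancel_le)
qed

text \<open>
  The displacement is centred, so its positive part carries half of its absolute mean.
\<close>
lemma quenched_max_ge: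
  "(\<integral>\<^sup>+\<xi>. ennreal \<bar>real_of_int (sum_list (map \<xi> ps))\<bar> \<partial>scenery)
    \<le> ennreal 2 * (\<integral>\<^sup>+\<xi>. ennreal (real_of_int (max_prefix_sum (map \<xi> ps))) \<partial>scenery)"
proof -
  let ?W = "\<lambda>\<xi>. real_of_int (sum_list (map \<xi> ps))"
  have eq: "\<bar>w\<bar> = 2 * max 0 w - w" for w :: real by (simp add: max_def)
  have i: "integrable scenery (\<lambda>\<xi>. max 0 (?W \<xi>))" using integrable_sum by auto
  have "(\<integral>\<^sup>+\<xi>. ennreal \<bar>?W \<xi>\<bar> \<partial>scenery) = ennreal (\<integral>\<xi>. \<bar>?W \<xi>\<bar> \<partial>scenery)"
    using integrable_sum by (intro nn_integral_eq_integral) auto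
  also have "(\<integral>\<xi>. \<bar>?W \<xi>\<bar> \<partial>scenery) = 2 * (\<integral>\<xi>. max 0 (?W \<xi>) \<partial>scenery)"
    unfolding eq using i integrable_sum by (simp add: expectation_sum)
  also have "ennreal \<dots> = ennreal 2 * ennreal (\<integral>\<xi>. max 0 (?W \<xi>) \<partial>scenery)"
    by (intro ennreal_mult integral_nonneg_AE) auto
  also have "ennreal (\<integral>\<xi>. max 0 (?W \<xi>) \<partial>scenery) = (\<integral>\<^sup>+\<xi>. ennreal (max 0 (?W \<xi>)) \<partial>scenery)"
    using i by (intro nn_integral_eq_integral[symmetric]) auto
  also have "\<dots> \<le> (\<integral>\<^sup>+\<xi>. ennreal (real_of_int (max_prefix_sum (map \<xi> ps))) \<partial>scenery)"
    by (intro nn_integral_mono ennreal_leI) (simp add: max_prefix_sum_nonneg sum_list_le_max_prefix_sum)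
  finally show ?thesis by (simp add: mult_left_mono)
qed

text \<open>
  The constant in the first-moment bound, from the pair of atoms at \<open>v\<close> and \<open>- v\<close>.
\<close>
definition dispersion :: "int \<Rightarrow> real" where
  "dispersion v = real_of_int v * (1 - exp (- (pmf \<mu> v / 2)))"

lemma mean_max_ge_near:
  assumes v: "0 < v" and R: "0 < R" and c: "2 * real n * ((1 - \<delta>) * nu_second) \<le> \<delta> * (real R)\<^sup>2"
  shows "ennreal (dispersion v / sqrt (real (2 * R + 1)) * (\<delta> * real n / 2)) \<le> ennreal 2 * mean_max n"
proof -
  let ?d = "dispersion v / sqrt (real (2 * R + 1))"
  have d: "0 \<le> dispersion v" using v by (simp add: dispersion_def pmf_nonneg)
  have le: "ennreal ?d * ennreal (real (length (filter (\<lambda>p. \<bar>real_of_int p\<bar> \<le> real R) ps)))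
     \<le> ennreal 2 * (\<integral>\<^sup>+\<xi>. ennreal (real_of_int (max_prefix_sum (map \<xi> ps))) \<partial>scenery)" for ps
  proof -
    have "?d * real (length (filter (\<lambda>p. \<bar>real_of_int p\<bar> \<le> real R) ps)) \<le> ?d * (sqrt (real (2 * R + 1)) * sqrt (occupation ps))"
      using d by (intro mult_left_mono near_length_le) auto
    also have "\<dots> = dispersion v * sqrt (occupation ps)" by simp
    also have "\<dots> \<le> (\<integral>\<xi>. \<bar>real_of_int (sum_list (map \<xi> ps))\<bar> \<partial>scenery)"
      unfolding dispersion_def by (rule sum_first_moment_ge[OF v])
    finally have "ennreal (?d * real (length (filter (\<lambda>p. \<bar>real_of_int p\<bar> \<le> real R) ps)))
       \<le> ennreal (\<integral>\<xi>. \<bar>real_of_int (sum_list (map \<xi> ps))\<bar> \<partial>scenery)"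
      by (rule ennreal_leI)
    also have "\<dots> = (\<integral>\<^sup>+\<xi>. ennreal \<bar>real_of_int (sum_list (map \<xi> ps))\<bar> \<partial>scenery)"
      using integrable_sum by (intro nn_integral_eq_integral[symmetric]) auto
    also note quenched_max_ge
    finally show ?thesis using d by (subst ennreal_mult[symmetric]) auto
  qed
  have "ennreal (?d * (\<delta> * real n / 2)) = ennreal ?d * ennreal (\<delta> * real n / 2)"
    using d delta by (intro ennreal_mult) auto
  also have "\<dots> \<le> ennreal ?d * (\<integral>\<^sup>+l. ennreal (real (length (filter (\<lambda>p. \<bar>real_of_int p\<bar> \<le> real R) (heights 0 l)))) \<partial>measure_pmf (paths n))"
    by (intro mult_left_mono mean_near_length[OF R c]) simp
  also have "\<dots> = (\<integral>\<^sup>+l. ennreal ?d * ennreal (real (length (filter (\<lambda>p. \<bar>real_of_int p\<bar> \<le> real R) (heights 0 l)))) \<partial>measure_pmf (paths n))"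
    by (rule nn_integral_cmult[symmetric]) simp
  also have "\<dots> \<le> (\<integral>\<^sup>+l. ennreal 2 * (\<integral>\<^sup>+\<xi>. ennreal (real_of_int (max_prefix_sum (map \<xi> (heights 0 l)))) \<partial>scenery) \<partial>measure_pmf (paths n))"
    by (intro nn_integral_mono le)
  also have "\<dots> = ennreal 2 * mean_max n"
    unfolding mean_max_def by (rule nn_integral_cmult) simp
  finally show ?thesis .
qed

text \<open>
  The choice \<open>R \<approx> b sqrt n\<close> in the preceding bound.
\<close>
lemma mean_max_ge:
  "\<exists>c>0. \<forall>n\<ge>1. ennreal (c * sqrt (real n * sqrt (real n))) \<le> mean_max n"
proof -
  obtain v where v: "0 < v" "v \<in> set_pmf \<mu>" using mu_nontrivial by blast
  have p: "0 < pmf \<mu> v" using v(2) by (simp add: pmf_positive)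
  have d: "0 < dispersion v" using v p by (simp add: dispersion_def)
  \<comment> \<open>\<open>b * sqrt n\<close> solves the condition on \<open>R\<close> with equality.\<close>
  define b where "b = sqrt (2 * ((1 - \<delta>) * nu_second) / \<delta>)"
  have b: "0 \<le> b" "\<delta> * b\<^sup>2 = 2 * ((1 - \<delta>) * nu_second)"
    using delta nu_second_nonneg by (auto simp: b_def)
  define B where "B = 2 * (b + 2) + 1"
  define c where "c = dispersion v * \<delta> / (4 * sqrt B)"
  have B: "0 < B" using b by (simp add: B_def)
  have c: "0 < c" using d delta B by (simp add: c_def)
  have "ennreal (c * sqrt (real n * sqrt (real n))) \<le> mean_max n" if n: "1 \<le> n" for n
  proof -
    let ?s = "sqrt (real n)"
    have s: "1 \<le> ?s" "?s\<^sup>2 = real n" using n by auto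
    define R where "R = nat \<lceil>b * ?s\<rceil> + 1"
    have R: "b * ?s \<le> real R" "real R \<le> b * ?s + 2" "0 < R"
    proof -
      have "0 \<le> b * ?s" using b s by simp
      then have "real R = of_int \<lceil>b * ?s\<rceil> + 1" by (simp add: R_def)
      then show "b * ?s \<le> real R" "real R \<le> b * ?s + 2" by linarith+
    qed (simp add: R_def)
    have "\<delta> * (b * ?s)\<^sup>2 \<le> \<delta> * (real R)\<^sup>2"
      using R b s delta by (intro mult_left_mono power_mono) auto
    moreover have "\<delta> * (b * ?s)\<^sup>2 = 2 * real n * ((1 - \<delta>) * nu_second)"
      using b(2) by (simp add: power_mult_distrib mult.assoc[symmetric])
    ultimately have cR: "2 * real n * ((1 - \<delta>) * nu_second) \<le> \<delta> * (real R)\<^sup>2" by simp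
    have "real (2 * R + 1) \<le> B * ?s"
    proof -
      have "real (2 * R + 1) \<le> 2 * (b * ?s + 2) + 1" using R by simp
      also have "\<dots> \<le> 2 * (b * ?s + 2 * ?s) + ?s" using s by simp
      finally show ?thesis by (simp add: B_def algebra_simps)
    qed
    then have "sqrt (real (2 * R + 1)) \<le> sqrt (B * ?s)" by (rule real_sqrt_le_mono)
    then have "dispersion v / sqrt (B * ?s) * (\<delta> * real n / 2) \<le> dispersion v / sqrt (real (2 * R + 1)) * (\<delta> * real n / 2)"
      using d delta B s by (intro mult_right_mono divide_left_mono mult_pos_pos) auto
    then have "ennreal (dispersion v / sqrt (B * ?s) * (\<delta> * real n / 2)) \<le> ennreal 2 * mean_max n"
      using mean_max_ge_near[OF v(1) R(3) cR] by (meson ennreal_leI order_trans)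
    also have "dispersion v / sqrt (B * ?s) * (\<delta> * real n / 2) = 2 * (c * sqrt (real n * ?s))"
    proof -
      have "0 < sqrt ?s" "sqrt ?s * sqrt ?s = ?s" "?s * ?s = real n" using s n by auto
      then have q: "real n / sqrt ?s = ?s * sqrt ?s" by (simp add: field_simps)
      have "dispersion v / sqrt (B * ?s) * (\<delta> * real n / 2) = dispersion v * \<delta> / (2 * sqrt B) * (real n / sqrt ?s)"
        by (simp add: real_sqrt_mult)
      then show ?thesis unfolding q by (simp add: c_def real_sqrt_mult)
    qed
    finally have "ennreal 2 * ennreal (c * sqrt (real n * ?s)) \<le> ennreal 2 * mean_max n"
      using c by (subst (asm) ennreal_mult) auto
    then show ?thesis
      by (subst (asm) ennreal_mult_le_mult_iff) auto
  qed
  with c show ?thesis by blast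
qed

section \<open>Positive correlation with one site\<close>

text \<open>
  Erasing the value at \<open>p\<close> makes the maximum independent of the site \<open>p\<close>.
\<close>
lemma resampled_site_indep:
  "scenery.prob {\<xi>. max_prefix_sum (map (\<xi>(p := 0)) ps) \<le> a \<and> \<xi> p \<in> B}
    = scenery.prob {\<xi>. max_prefix_sum (map (\<xi>(p := 0)) ps) \<le> a} * measure_pmf.prob \<mu> B"
proof -
  let ?N1 = "PiM {p} (\<lambda>_::int. measure_pmf \<mu>)" and ?N2 = "PiM (- {p}) (\<lambda>_::int. measure_pmf \<mu>)"
  let ?A2 = "{f \<in> space ?N2. max_prefix_sum (map (\<lambda>z. if z = p then 0 else f z) ps) \<le> a}"
  have ind: "scenery.indep_var ?N1 (\<lambda>\<xi>. restrict (\<lambda>i. \<xi> i) {p}) ?N2 (\<lambda>\<xi>. restrict (\<lambda>i. \<xi> i) (- {p}))"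
    by (rule scenery.indep_var_restrict[OF indep_coordinates]) auto
  have c1: "(\<lambda>f. f p) \<in> measurable ?N1 (count_space UNIV)"
    using measurable_component_singleton[of p "{p}" "\<lambda>_. measure_pmf \<mu>"] by simp
  have s1: "{f \<in> space ?N1. f p \<in> B} \<in> sets ?N1"
    using measurable_sets[OF c1, of B] by (simp add: vimage_def Int_def conj_commute)
  have c2: "(\<lambda>f. if z = p then 0 else f z) \<in> measurable ?N2 (count_space UNIV)" for z
    using measurable_component_singleton[of z "- {p}" "\<lambda>_. measure_pmf \<mu>"] by (cases "z = p") auto
  have s2: "?A2 \<in> sets ?N2"
    using measurable_sets[OF map_measurable[of ps "\<lambda>z f. if z = p then 0 else f z" ?N2], of "{as. max_prefix_sum as \<le> a}"] c2
    by (simp add: vimage_def Int_def conj_commute)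
  have r: "map (\<lambda>z. if z = p then 0 else restrict \<xi> (- {p}) z) ps = map (\<xi>(p := 0)) ps" for \<xi> :: "int \<Rightarrow> int"
    by auto
  have sp: "restrict \<xi> A \<in> space (PiM A (\<lambda>_. measure_pmf \<mu>))" for \<xi> :: "int \<Rightarrow> int" and A
    by (simp add: space_PiM)
  have "scenery.prob ((\<lambda>x. (restrict (\<lambda>i. x i) {p}, restrict (\<lambda>i. x i) (- {p}))) -` ({f \<in> space ?N1. f p \<in> B} \<times> ?A2) \<inter> space scenery)
    = scenery.prob ((\<lambda>\<xi>. restrict (\<lambda>i. \<xi> i) {p}) -` {f \<in> space ?N1. f p \<in> B} \<inter> space scenery)
      * scenery.prob ((\<lambda>\<xi>. restrict (\<lambda>i. \<xi> i) (- {p})) -` ?A2 \<inter> space scenery)"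
    by (rule scenery.indep_varD[OF ind s1 s2])
  then have "scenery.prob {\<xi>. \<xi> p \<in> B \<and> max_prefix_sum (map (\<xi>(p := 0)) ps) \<le> a}
    = scenery.prob {\<xi>. \<xi> p \<in> B} * scenery.prob {\<xi>. max_prefix_sum (map (\<xi>(p := 0)) ps) \<le> a}"
    by (simp only: vimage_def mem_Times_iff fst_conv snd_conv mem_Collect_eq r sp restrict_apply' insertI1 simp_thms space_scenery Int_UNIV_right)
  moreover have "scenery.prob {\<xi>. \<xi> p \<in> B} = measure_pmf.prob \<mu> B"
    using arg_cong[OF distr_coordinate[of p], of "\<lambda>N. measure N B"] coordinate_measurable[of id "measure_pmf \<mu>" p]
    by (simp add: measure_distr vimage_def)
  ultimately show ?thesis by (simp add: conj_commute mult.commute)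
qed

definition neg_prob :: real where
  "neg_prob = measure_pmf.prob \<mu> {..- 1}"

lemma neg_prob_pos: "0 < neg_prob"
proof -
  obtain v where v: "0 < v" "v \<in> set_pmf \<mu>" using mu_nontrivial by blast
  then have "- v \<in> set_pmf (map_pmf uminus \<mu>)" by simp
  then have "- v \<in> set_pmf \<mu>" by (simp only: mu_symmetric)
  then show ?thesis
    unfolding neg_prob_def using v by (intro measure_pmf_posI) auto
qed

text \<open>
  Harris' inequality for a single site. The maximum increases with the value at \<open>p\<close>, so on
  \<open>\<xi> p \<le> - 1\<close> the event contains the one with the site erased, and on \<open>\<xi> p \<ge> 0\<close> it is contained in it;
  the erased event is independent of \<open>\<xi> p\<close>.
\<close>
lemma harris_one_site:
  "neg_prob * scenery.prob {\<xi>. max_prefix_sum (map \<xi> ps) \<le> a}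
    \<le> scenery.prob {\<xi>. \<xi> p \<le> - 1 \<and> max_prefix_sum (map \<xi> ps) \<le> a}"
proof -
  let ?M = "\<lambda>\<xi>. max_prefix_sum (map \<xi> ps) \<le> a"
  let ?R = "\<lambda>\<xi>::int \<Rightarrow> int. max_prefix_sum (map (\<xi>(p := 0)) ps) \<le> a"
  have ev: "{\<xi>. Q (\<xi> p) (map \<xi> ps)} \<in> scenery.events" for Q
    using measurable_sets[OF two_point_measurable[of Q "count_space UNIV" p ps], of "{True}"]
    by (simp add: vimage_def)
  have m0: "(\<lambda>\<xi>. map (\<xi>(p := 0)) ps) \<in> measurable scenery (count_space UNIV)"
    using map_measurable[of ps "\<lambda>z \<xi>. if z = p then 0 else \<xi> z" scenery] coordinate_measurable_discrete
    by (simp add: fun_upd_def)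
  have ev0: "{\<xi>. ?R \<xi> \<and> Q (\<xi> p)} \<in> scenery.events" for Q
  proof -
    have "(\<lambda>\<xi>. max_prefix_sum (map (\<xi>(p := 0)) ps)) \<in> measurable scenery (count_space UNIV)"
      by (rule measurable_compose[OF m0]) simp
    note [measurable] = this coordinate_measurable_discrete
    have "{\<xi>\<in>space scenery. ?R \<xi> \<and> Q (\<xi> p)} \<in> scenery.events" by measurable
    then show ?thesis by simp
  qed
  have q: "measure_pmf.prob \<mu> {0..} = 1 - neg_prob"
  proof -
    have "{0..} = UNIV - {..- 1::int}" by auto
    then show ?thesis using measure_pmf.prob_compl[of "{..- 1}" \<mu>] by (simp add: neg_prob_def)
  qed
  have "neg_prob * scenery.prob {\<xi>. ?R \<xi>} = scenery.prob {\<xi>. ?R \<xi> \<and> \<xi> p \<in> {..- 1}}"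
    by (simp only: resampled_site_indep neg_prob_def mult.commute)
  also have "\<dots> \<le> scenery.prob {\<xi>. \<xi> p \<le> - 1 \<and> ?M \<xi>}"
  proof (rule scenery.finite_measure_mono[OF _ ev])
    have "?M \<xi>" if "?R \<xi>" "\<xi> p \<le> - 1" for \<xi>
      using that max_prefix_sum_mono[of \<xi> "\<xi>(p := 0)" ps] by fastforce
    then show "{\<xi>. ?R \<xi> \<and> \<xi> p \<in> {..- 1}} \<subseteq> {\<xi>. \<xi> p \<le> - 1 \<and> ?M \<xi>}" by auto
  qed
  finally have neg: "neg_prob * scenery.prob {\<xi>. ?R \<xi>} \<le> scenery.prob {\<xi>. \<xi> p \<le> - 1 \<and> ?M \<xi>}" .
  have "scenery.prob {\<xi>. 0 \<le> \<xi> p \<and> ?M \<xi>} \<le> scenery.prob {\<xi>. ?R \<xi> \<and> \<xi> p \<in> {0..}}"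
  proof (rule scenery.finite_measure_mono[OF _ ev0])
    have "?R \<xi>" if "?M \<xi>" "0 \<le> \<xi> p" for \<xi>
      using that max_prefix_sum_mono[of "\<xi>(p := 0)" \<xi> ps] by fastforce
    then show "{\<xi>. 0 \<le> \<xi> p \<and> ?M \<xi>} \<subseteq> {\<xi>. ?R \<xi> \<and> \<xi> p \<in> {0..}}" by auto
  qed
  also have "\<dots> = (1 - neg_prob) * scenery.prob {\<xi>. ?R \<xi>}"
    by (simp only: resampled_site_indep q mult.commute)
  finally have pos: "scenery.prob {\<xi>. 0 \<le> \<xi> p \<and> ?M \<xi>} \<le> (1 - neg_prob) * scenery.prob {\<xi>. ?R \<xi>}" .
  have "{\<xi>. ?M \<xi>} = {\<xi>. \<xi> p \<le> - 1 \<and> ?M \<xi>} \<union> {\<xi>. 0 \<le> \<xi> p \<and> ?M \<xi>}" by auto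
  also have "scenery.prob \<dots> = scenery.prob {\<xi>. \<xi> p \<le> - 1 \<and> ?M \<xi>} + scenery.prob {\<xi>. 0 \<le> \<xi> p \<and> ?M \<xi>}"
    using ev by (intro scenery.finite_measure_Union) auto
  finally have split: "scenery.prob {\<xi>. ?M \<xi>} = scenery.prob {\<xi>. \<xi> p \<le> - 1 \<and> ?M \<xi>} + scenery.prob {\<xi>. 0 \<le> \<xi> p \<and> ?M \<xi>}" .
  have "neg_prob \<le> 1" by (simp add: neg_prob_def)
  then have "neg_prob * scenery.prob {\<xi>. 0 \<le> \<xi> p \<and> ?M \<xi>} \<le> (1 - neg_prob) * (neg_prob * scenery.prob {\<xi>. ?R \<xi>})"
    using mult_left_mono[OF pos, of neg_prob] neg_prob_pos by (simp add: ac_simps)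
  also have "\<dots> \<le> (1 - neg_prob) * scenery.prob {\<xi>. \<xi> p \<le> - 1 \<and> ?M \<xi>}"
    using neg \<open>neg_prob \<le> 1\<close> by (intro mult_left_mono) auto
  finally show ?thesis unfolding split by (simp add: algebra_simps)
qed

section \<open>Persistence from above\<close>

definition persistence :: "int \<Rightarrow> nat \<Rightarrow> ennreal" where
  "persistence a n = (\<integral>\<^sup>+l. emeasure scenery {\<xi>. max_prefix_sum (map \<xi> (heights 0 l)) \<le> a} \<partial>measure_pmf (paths n))"

lemma sample_event: "{\<xi>. P (map \<xi> ps)} \<in> scenery.events"
  using measurable_sets[OF sample_measurable[of P "count_space UNIV" ps], of "{True}"]
  by (simp add: vimage_def)

lemma two_point_event: "{\<xi>. P (\<xi> p) (map \<xi> ps)} \<in> scenery.events"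
  using sample_event[of "\<lambda>as. P (hd as) (tl as)" "p # ps"] by simp

lemma persistence_le_one: "persistence a n \<le> 1"
proof -
  have "persistence a n \<le> (\<integral>\<^sup>+l. 1 \<partial>measure_pmf (paths n))"
    unfolding persistence_def by (intro nn_integral_mono scenery.emeasure_le_1)
  then show ?thesis by simp
qed

lemma persistence_antimono: "persistence a (n + k) \<le> persistence a n"
proof -
  have "persistence a (n + k) \<le> (\<integral>\<^sup>+l. \<integral>\<^sup>+l'. emeasure scenery {\<xi>. max_prefix_sum (map \<xi> (heights 0 l)) \<le> a} \<partial>measure_pmf (paths k) \<partial>measure_pmf (paths n))"
    unfolding persistence_def nn_integral_paths_add
  proof (intro nn_integral_mono emeasure_mono sample_event subsetI CollectI, elim CollectE)
    fix l l' and \<xi> :: "int \<Rightarrow> int"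
    assume "max_prefix_sum (map \<xi> (heights 0 (l @ l'))) \<le> a"
    then show "max_prefix_sum (map \<xi> (heights 0 l)) \<le> a"
      using max_prefix_sum_extend[of \<xi> 0 l l'] by (rule order_trans[rotated])
  qed
  then show ?thesis by (simp add: persistence_def)
qed

lemma persistence_harris:
  "ennreal neg_prob * persistence a n
    \<le> (\<integral>\<^sup>+l. emeasure scenery {\<xi>. \<xi> 0 \<le> - 1 \<and> max_prefix_sum (map \<xi> (heights 0 l)) \<le> a} \<partial>measure_pmf (paths n))"
proof -
  have "ennreal neg_prob * persistence a n = (\<integral>\<^sup>+l. ennreal neg_prob * emeasure scenery {\<xi>. max_prefix_sum (map \<xi> (heights 0 l)) \<le> a} \<partial>measure_pmf (paths n))"
    unfolding persistence_def by (rule nn_integral_cmult[symmetric]) simp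
  also have "\<dots> \<le> (\<integral>\<^sup>+l. emeasure scenery {\<xi>. \<xi> 0 \<le> - 1 \<and> max_prefix_sum (map \<xi> (heights 0 l)) \<le> a} \<partial>measure_pmf (paths n))"
    using harris_one_site neg_prob_pos
    by (intro nn_integral_mono) (auto simp: scenery.emeasure_eq_measure intro!: ennreal_leI simp flip: ennreal_mult)
  finally show ?thesis .
qed

lemma persistence_Suc_ge:
  "ennreal \<delta> * (\<integral>\<^sup>+l. emeasure scenery {\<xi>. max_prefix_sum (map \<xi> (0 # heights 0 l)) \<le> a} \<partial>measure_pmf (paths n))
    \<le> persistence a (Suc n)"
  unfolding persistence_def nn_integral_paths_Suc heights.simps by simp

text \<open>
  After a first horizontal step with \<open>\<xi> 0 \<le> - 1\<close> the rest of the path may rise by \<open>1\<close> without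
  crossing the barrier \<open>0\<close>. The rest may visit the same site again, so it is not independent of this
  step, and positive correlation takes the place of independence.
\<close>
lemma persistence_one_to_zero:
  "ennreal (\<delta> * neg_prob) * persistence 1 n \<le> persistence 0 (Suc n)"
proof -
  have "ennreal (\<delta> * neg_prob) * persistence 1 n = ennreal \<delta> * (ennreal neg_prob * persistence 1 n)"
    using delta neg_prob_pos by (simp add: ennreal_mult mult.assoc)
  also have "\<dots> \<le> ennreal \<delta> * (\<integral>\<^sup>+l. emeasure scenery {\<xi>. \<xi> 0 \<le> - 1 \<and> max_prefix_sum (map \<xi> (heights 0 l)) \<le> 1} \<partial>measure_pmf (paths n))"
    by (intro mult_left_mono persistence_harris) simp
  also have "\<dots> \<le> ennreal \<delta> * (\<integral>\<^sup>+l. emeasure scenery {\<xi>. max_prefix_sum (map \<xi> (0 # heights 0 l)) \<le> 0} \<partial>measure_pmf (paths n))"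
    by (intro mult_left_mono nn_integral_mono emeasure_mono sample_event) auto
  also have "\<dots> \<le> persistence 0 (Suc n)" by (rule persistence_Suc_ge)
  finally show ?thesis .
qed

text \<open>
  Integer values enter here: a negative integer is at most \<open>- 1\<close>, so the mean undershoot dominates
  a probability.
\<close>
lemma persistence_zero_le_undershoot:
  "ennreal neg_prob * persistence 0 n \<le> mean_undershoot n"
proof -
  have "(\<integral>\<^sup>+l. emeasure scenery {\<xi>. \<xi> 0 \<le> - 1 \<and> max_prefix_sum (map \<xi> (heights 0 l)) \<le> 0} \<partial>measure_pmf (paths n)) \<le> mean_undershoot n"
    unfolding mean_undershoot_def
  proof (rule nn_integral_mono)
    fix l
    let ?E = "{\<xi>. \<xi> 0 \<le> - 1 \<and> max_prefix_sum (map \<xi> (heights 0 l)) \<le> 0}"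
    have "emeasure scenery ?E = (\<integral>\<^sup>+\<xi>. indicator ?E \<xi> \<partial>scenery)"
      by (rule nn_integral_indicator[symmetric], rule two_point_event)
    also have "\<dots> \<le> (\<integral>\<^sup>+\<xi>. ennreal (- real_of_int (\<xi> 0 + max_prefix_sum (map \<xi> (heights 0 l)))) \<partial>scenery)"
    proof (rule nn_integral_mono)
      fix \<xi>
      show "indicator ?E \<xi> \<le> ennreal (- real_of_int (\<xi> 0 + max_prefix_sum (map \<xi> (heights 0 l))))"
      proof (cases "\<xi> \<in> ?E")
        case True
        then have "1 \<le> - real_of_int (\<xi> 0 + max_prefix_sum (map \<xi> (heights 0 l)))" by simp
        then have "ennreal 1 \<le> ennreal (- real_of_int (\<xi> 0 + max_prefix_sum (map \<xi> (heights 0 l))))"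
          by (rule ennreal_leI)
        then show ?thesis using True by simp
      qed simp
    qed
    finally show "emeasure scenery ?E \<le> (\<integral>\<^sup>+\<xi>. ennreal (- real_of_int (\<xi> 0 + max_prefix_sum (map \<xi> (heights 0 l)))) \<partial>scenery)" .
  qed
  with persistence_harris[of 0 n] show ?thesis by (rule order_trans)
qed

text \<open>
  A barrier at \<open>1\<close> costs a constant factor compared with the undershoot, and concavity bounds the
  slope of \<^term>\<open>mean_max\<close> by its value divided by the time.
\<close>
lemma persistence_upper:
  "\<exists>C>0. \<forall>n. persistence 1 n \<le> ennreal (C * real (n + 1) powr (-1/4))"
proof -
  define k where "k = (\<delta> * neg_prob)\<^sup>2"
  have k: "0 < k" using delta neg_prob_pos by (simp add: k_def)
  define C where "C = (max_const + 1) / k"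
  have "persistence 1 n \<le> ennreal (C * real (n + 1) powr (-1/4))" for n
  proof -
    let ?m = "real (n + 1)"
    have "ennreal (?m * k) * persistence 1 n = of_nat (Suc n) * (ennreal \<delta> * (ennreal neg_prob * (ennreal (\<delta> * neg_prob) * persistence 1 n)))"
      using delta neg_prob_pos
      by (simp add: k_def power2_eq_square ennreal_mult mult.assoc ennreal_of_nat_eq_real_of_nat)
    also have "\<dots> \<le> of_nat (Suc n) * (ennreal \<delta> * (ennreal neg_prob * persistence 0 (Suc n)))"
      by (intro mult_left_mono persistence_one_to_zero) auto
    also have "\<dots> \<le> of_nat (Suc n) * (ennreal \<delta> * mean_undershoot (Suc n))"
      by (intro mult_left_mono persistence_zero_le_undershoot) auto
    also have "\<dots> \<le> mean_max (Suc n)" by (rule mean_undershoot_le)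
    also have "\<dots> \<le> ennreal ((max_const + 1) * sqrt (?m * sqrt ?m))"
      using mean_max_le[of "Suc n"] by simp
    also have "sqrt (?m * sqrt ?m) = ?m powr (3/4)" by (rule sqrt_sqrt_powr) simp
    finally have "ennreal (1 / (?m * k)) * (ennreal (?m * k) * persistence 1 n) \<le> ennreal (1 / (?m * k)) * ennreal ((max_const + 1) * ?m powr (3/4))"
      by (rule mult_left_mono) simp
    also have "ennreal (1 / (?m * k)) * (ennreal (?m * k) * persistence 1 n) = persistence 1 n"
      using k unfolding mult.assoc[symmetric] by (subst ennreal_mult[symmetric]) auto
    also have "ennreal (1 / (?m * k)) * ennreal ((max_const + 1) * ?m powr (3/4)) = ennreal (C * ?m powr (-1/4))"
    proof -
      have "?m powr (3/4) = ?m powr (-1/4) * ?m"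
        using powr_add[of ?m "-1/4" 1] by simp
      then have "1 / (?m * k) * ((max_const + 1) * ?m powr (3/4)) = C * ?m powr (-1/4)"
        using k by (simp add: C_def del: of_nat_Suc of_nat_add)
      then show ?thesis
        using k max_const_nonneg by (subst ennreal_mult[symmetric]) auto
    qed
    finally show ?thesis .
  qed
  moreover have "0 < C" using k max_const_nonneg by (simp add: C_def)
  ultimately show ?thesis by blast
qed

section \<open>Persistence from below\<close>

definition step_tail :: "real \<Rightarrow> ennreal" where
  "step_tail b = (\<integral>\<^sup>+x. ennreal (real_of_int x) * indicator {x. b < real_of_int x} x \<partial>measure_pmf \<mu>)"

text \<open>
  The undershoot is at most \<open>- \<xi> 0\<close>. Values up to \<open>b\<close> are charged to the event that the maximum
  stays below the barrier after a horizontal first step, larger ones to the tail of the scenery.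
\<close>
lemma undershoot_le_persistence:
  assumes b: "0 \<le> b"
  shows "ennreal \<delta> * mean_undershoot n \<le> ennreal b * persistence 1 n + step_tail b"
proof -
  let ?E = "\<lambda>l. {\<xi>. \<xi> 0 + max_prefix_sum (map \<xi> (heights 0 l)) \<le> - 1}"
  have tail: "(\<integral>\<^sup>+\<xi>. ennreal (- real_of_int (\<xi> 0)) * indicator {x. b < - real_of_int x} (\<xi> 0) \<partial>scenery) = step_tail b"
    using nn_integral_coordinate[of "\<lambda>x. ennreal (- real_of_int x) * indicator {x. b < - real_of_int x} x" 0]
      mu_reflect[of "\<lambda>x. ennreal (real_of_int x) * indicator {x. b < real_of_int x} x"]
    by (simp add: step_tail_def indicator_def)
  have q: "(\<integral>\<^sup>+\<xi>. ennreal (- real_of_int (\<xi> 0 + max_prefix_sum (map \<xi> (heights 0 l)))) \<partial>scenery)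
      \<le> ennreal b * emeasure scenery (?E l) + step_tail b" for l
  proof -
    let ?m = "\<lambda>\<xi>. max_prefix_sum (map \<xi> (heights 0 l))"
    have ev: "?E l \<in> scenery.events" by (rule two_point_event)
    have "(\<integral>\<^sup>+\<xi>. ennreal (- real_of_int (\<xi> 0 + ?m \<xi>)) \<partial>scenery)
      \<le> (\<integral>\<^sup>+\<xi>. ennreal b * indicator (?E l) \<xi> + ennreal (- real_of_int (\<xi> 0)) * indicator {x. b < - real_of_int x} (\<xi> 0) \<partial>scenery)"
    proof (rule nn_integral_mono)
      fix \<xi>
      have m: "0 \<le> ?m \<xi>" by (rule max_prefix_sum_nonneg)
      show "ennreal (- real_of_int (\<xi> 0 + ?m \<xi>)) \<le> ennreal b * indicator (?E l) \<xi> + ennreal (- real_of_int (\<xi> 0)) * indicator {x. b < - real_of_int x} (\<xi> 0)"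
      proof (cases "\<xi> 0 + ?m \<xi> \<le> - 1")
        case False
        then have "- real_of_int (\<xi> 0 + ?m \<xi>) \<le> 0" by linarith
        then show ?thesis by (simp add: ennreal_neg)
      next
        case True
        have le: "- real_of_int (\<xi> 0 + ?m \<xi>) \<le> - real_of_int (\<xi> 0)" using m by simp
        show ?thesis
        proof (cases "b < - real_of_int (\<xi> 0)")
          case True
          then show ?thesis using le by (auto intro!: ennreal_leI add_increasing)
        next
          case False
          then have "- real_of_int (\<xi> 0 + ?m \<xi>) \<le> b" using le by linarith
          then show ?thesis using True False by (auto intro!: ennreal_leI)
        qed
      qed
    qed
    also have "\<dots> = ennreal b * emeasure scenery (?E l) + step_tail b"
      unfolding tail[symmetric] using ev
      by (subst nn_integral_add) (auto simp: nn_integral_cmult_indicator intro!: borel_measurable_times coordinate_measurable borel_measurable_indicator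
          intro: coordinate_measurable[of "\<lambda>x. ennreal (- real_of_int x) * indicator {x. b < - real_of_int x} x"])
    finally show ?thesis .
  qed
  have "ennreal \<delta> * mean_undershoot n \<le> ennreal \<delta> * (\<integral>\<^sup>+l. ennreal b * emeasure scenery (?E l) + step_tail b \<partial>measure_pmf (paths n))"
    unfolding mean_undershoot_def by (intro mult_left_mono nn_integral_mono q) simp
  also have "\<dots> = ennreal \<delta> * (ennreal b * (\<integral>\<^sup>+l. emeasure scenery (?E l) \<partial>measure_pmf (paths n)) + step_tail b)"
    by (simp add: nn_integral_add nn_integral_cmult)
  also have "\<dots> = ennreal b * (ennreal \<delta> * (\<integral>\<^sup>+l. emeasure scenery (?E l) \<partial>measure_pmf (paths n))) + ennreal \<delta> * step_tail b"
    by (simp add: algebra_simps)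
  also have "\<dots> \<le> ennreal b * persistence 1 n + 1 * step_tail b"
  proof (intro add_mono mult_left_mono mult_right_mono)
    have "ennreal \<delta> * (\<integral>\<^sup>+l. emeasure scenery (?E l) \<partial>measure_pmf (paths n))
      \<le> ennreal \<delta> * (\<integral>\<^sup>+l. emeasure scenery {\<xi>. max_prefix_sum (map \<xi> (0 # heights 0 l)) \<le> 1} \<partial>measure_pmf (paths n))"
      by (intro mult_left_mono nn_integral_mono emeasure_mono sample_event) auto
    also have "\<dots> \<le> persistence 1 (Suc n)" by (rule persistence_Suc_ge)
    also have "\<dots> \<le> persistence 1 n" using persistence_antimono[of 1 n 1] by simp
    finally show "ennreal \<delta> * (\<integral>\<^sup>+l. emeasure scenery (?E l) \<partial>measure_pmf (paths n)) \<le> persistence 1 n" .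
    show "ennreal \<delta> \<le> 1" using delta by simp
  qed auto
  finally show ?thesis by simp
qed

text \<open>
  By concavity the slope of \<^term>\<open>mean_max\<close> at time \<open>n\<close> is at least its mean slope from \<open>n\<close> to
  a large multiple of \<open>n\<close>.
\<close>
lemma undershoot_ge:
  "\<exists>c>0. \<forall>n\<ge>1. ennreal (c * real n powr (-1/4)) \<le> ennreal \<delta> * mean_undershoot n"
proof -
  obtain c where c: "0 < c" "\<And>n. n \<ge> 1 \<Longrightarrow> ennreal (c * sqrt (real n * sqrt (real n))) \<le> mean_max n"
    using mean_max_ge by blast
  define L where "L = max_const + 1"
  have L: "0 < L" using max_const_nonneg by (simp add: L_def)
  \<comment> \<open>At time \<open>k ^ 4 * n\<close> the lower bound \<open>c * k ^ 3 * n powr (3/4)\<close> exceeds the upper bound at time \<open>n\<close> by \<open>n powr (3/4)\<close>.\<close>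
  define k where "k = nat \<lceil>(L + 1) / c\<rceil> + 1"
  have k1: "1 \<le> real k" by (simp add: k_def)
  have "(L + 1) / c \<le> real k" unfolding k_def by linarith
  then have kc: "L + 1 \<le> c * real k" using c(1) by (simp add: field_simps)
  also have "c * real k \<le> c * real k ^ 3"
    using k1 c(1) power_increasing[of 1 3 "real k"] by (intro mult_left_mono) auto
  finally have k: "L + 1 \<le> c * real k ^ 3" .
  have "ennreal (1 / real (k ^ 4) * real n powr (-1/4)) \<le> ennreal \<delta> * mean_undershoot n" if n: "1 \<le> n" for n
  proof -
    let ?s = "sqrt (real n * sqrt (real n))"
    have kpos: "0 < k" using k1 by simp
    have s0: "0 < ?s" using n by simp
    have kn: "n \<le> k ^ 4 * n" "1 \<le> k ^ 4 * n" using k1 n by auto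
    have "sqrt (real (k ^ 4 * n) * sqrt (real (k ^ 4 * n))) = real k ^ 3 * ?s"
    proof -
      have "sqrt (real k ^ 4) = real k ^ 2" by (simp add: real_sqrt_unique power_mult[symmetric])
      then have eq: "real (k ^ 4 * n) * sqrt (real (k ^ 4 * n)) = (real k ^ 3)\<^sup>2 * (real n * sqrt (real n))"
        by (simp add: real_sqrt_mult power_mult[symmetric] power_add[symmetric])
      show ?thesis unfolding eq real_sqrt_mult[of "(real k ^ 3)\<^sup>2"] real_sqrt_abs by simp
    qed
    moreover have "(L + 1) * ?s \<le> c * (real k ^ 3 * ?s)"
      using mult_right_mono[OF k, of ?s] s0 by (simp add: mult.assoc)
    ultimately have "ennreal ((L + 1) * ?s) \<le> ennreal (c * sqrt (real (k ^ 4 * n) * sqrt (real (k ^ 4 * n))))"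
      by (intro ennreal_leI) simp
    also have "\<dots> \<le> mean_max (k ^ 4 * n)" by (rule c(2)[OF kn(2)])
    also have "\<dots> \<le> mean_max n + of_nat (k ^ 4 * n - n) * (ennreal \<delta> * mean_undershoot n)"
      using mean_max_add_le[of n "k ^ 4 * n - n"] kn(1) by simp
    also have "\<dots> \<le> ennreal (L * ?s) + of_nat (k ^ 4 * n) * (ennreal \<delta> * mean_undershoot n)"
      unfolding L_def by (intro add_mono mean_max_le mult_right_mono of_nat_mono) auto
    finally have "ennreal (L * ?s) + ennreal ?s \<le> ennreal (L * ?s) + of_nat (k ^ 4 * n) * (ennreal \<delta> * mean_undershoot n)"
      using L s0 by (simp add: distrib_right)
    then have "ennreal ?s \<le> ennreal (real (k ^ 4 * n)) * (ennreal \<delta> * mean_undershoot n)"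
      by (simp add: ennreal_add_left_cancel_le ennreal_of_nat_eq_real_of_nat)
    moreover have "ennreal ?s = ennreal (real (k ^ 4 * n)) * ennreal (1 / real (k ^ 4) * real n powr (-1/4))"
    proof -
      have "?s = real n powr (3/4)" using n by (intro sqrt_sqrt_powr) simp
      also have "\<dots> = real n * real n powr (-1/4)" using powr_add[of "real n" 1 "-1/4"] n by simp
      finally have "?s = real (k ^ 4 * n) * (1 / real (k ^ 4) * real n powr (-1/4))" using k1 by simp
      then show ?thesis by (subst ennreal_mult[symmetric]) auto
    qed
    ultimately show ?thesis
      using kn(2) kpos by (simp only:) (subst (asm) ennreal_mult_le_mult_iff; simp)
  qed
  moreover have "0 < 1 / real (k ^ 4)" using k1 by simp
  ultimately show ?thesis by blast
qed

lemma step_tail_exponential: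
  assumes "integrable (measure_pmf \<mu>) (\<lambda>x. exp (real_of_int x))"
  shows "\<exists>C>0. \<forall>b\<ge>0. step_tail b \<le> ennreal (C * exp (- b / 2))"
proof -
  let ?C = "2 * measure_pmf.expectation \<mu> (\<lambda>x. exp (real_of_int x)) + 1"
  have e0: "0 \<le> measure_pmf.expectation \<mu> (\<lambda>x. exp (real_of_int x))" by (rule integral_nonneg_AE) simp
  have "step_tail b \<le> ennreal (?C * exp (- b / 2))" if "0 \<le> b" for b
  proof -
    have "step_tail b \<le> (\<integral>\<^sup>+x. ennreal (2 * exp (- b / 2)) * ennreal (exp (real_of_int x)) \<partial>measure_pmf \<mu>)"
      unfolding step_tail_def
    proof (rule nn_integral_mono)
      fix x
      show "ennreal (real_of_int x) * indicator {x. b < real_of_int x} x \<le> ennreal (2 * exp (- b / 2)) * ennreal (exp (real_of_int x))"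
      proof (cases "b < real_of_int x")
        case True
        have "real_of_int x \<le> 2 * exp (real_of_int x / 2)"
          using exp_ge_add_one_self[of "real_of_int x / 2"] by linarith
        also have "\<dots> \<le> 2 * exp (real_of_int x - b / 2)" using True by simp
        also have "\<dots> = 2 * exp (- b / 2) * exp (real_of_int x)" by (simp add: exp_add[symmetric])
        finally have "ennreal (real_of_int x) \<le> ennreal (2 * exp (- b / 2) * exp (real_of_int x))" by (rule ennreal_leI)
        then show ?thesis using True by (simp add: ennreal_mult)
      qed simp
    qed
    also have "\<dots> = ennreal (2 * exp (- b / 2)) * ennreal (measure_pmf.expectation \<mu> (\<lambda>x. exp (real_of_int x)))"
      using assms by (simp add: nn_integral_cmult nn_integral_eq_integral)
    also have "\<dots> \<le> ennreal (?C * exp (- b / 2))"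
      using e0 by (subst ennreal_mult[symmetric]) (auto intro!: ennreal_leI simp: algebra_simps)
    finally show ?thesis .
  qed
  moreover have "0 < ?C" using e0 by linarith
  ultimately show ?thesis by blast
qed

text \<open>
  Cutting the scenery at \<open>ln n\<close> leaves a tail of order \<open>n powr (-1/2)\<close>, which is negligible
  against \<open>n powr (-1/4)\<close>.
\<close>
lemma persistence_lower:
  assumes "integrable (measure_pmf \<mu>) (\<lambda>x. exp (real_of_int x))"
  shows "\<exists>c>0. \<forall>\<^sub>F n in sequentially. ennreal (c * real n powr (-1/4) / ln (real n)) \<le> persistence 1 n"
proof -
  obtain c where c: "0 < c" "\<And>n. n \<ge> 1 \<Longrightarrow> ennreal (c * real n powr (-1/4)) \<le> ennreal \<delta> * mean_undershoot n"
    using undershoot_ge by blast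
  obtain C where C: "0 < C" "\<And>b. b \<ge> 0 \<Longrightarrow> step_tail b \<le> ennreal (C * exp (- b / 2))"
    using step_tail_exponential[OF assms] by blast
  have "eventually (\<lambda>n. C * real n powr (-1/2) \<le> c / 2 * real n powr (-1/4)) sequentially"
    using C(1) c(1) by real_asymp
  moreover have "eventually (\<lambda>n::nat. 0 < ln (real n)) sequentially" by real_asymp
  moreover have "eventually (\<lambda>n::nat. 1 \<le> n) sequentially" by (rule eventually_ge_at_top)
  ultimately have "\<forall>\<^sub>F n in sequentially. ennreal (c / 2 * real n powr (-1/4) / ln (real n)) \<le> persistence 1 n"
  proof eventually_elim
    case (elim n)
    obtain P where P: "0 \<le> P" "persistence 1 n = ennreal P"
      using persistence_le_one[of 1 n] by (cases "persistence 1 n") (auto simp: top_unique)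
    \<comment> \<open>The cut \<open>b = ln n\<close>.\<close>
    have "exp (- ln (real n) / 2) = real n powr (-1/2)"
      using elim(3) by (simp add: powr_def)
    then have "ennreal (c * real n powr (-1/4)) \<le> ennreal (ln (real n)) * ennreal P + ennreal (C * real n powr (-1/2))"
      using c(2)[OF elim(3)] undershoot_le_persistence[of "ln (real n)" n] C(2)[of "ln (real n)"] elim(2)
      by (auto simp: P(2) intro: order_trans add_left_mono)
    also have "\<dots> = ennreal (ln (real n) * P + C * real n powr (-1/2))"
      using P(1) C(1) elim(2) by (subst ennreal_plus) (auto simp: ennreal_mult)
    finally have "c * real n powr (-1/4) \<le> ln (real n) * P + C * real n powr (-1/2)"
      using P(1) C(1) elim(2) by (subst (asm) ennreal_le_iff) auto
    then have "c / 2 * real n powr (-1/4) \<le> ln (real n) * P" using elim(1) by simp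
    then have "c / 2 * real n powr (-1/4) / ln (real n) \<le> P" using elim(2) by (simp add: field_simps)
    then show ?case unfolding P(2) by (rule ennreal_leI)
  qed
  with c(1) show ?thesis by (intro exI[of _ "c / 2"]) auto
qed

end

section \<open>The annealed process\<close>

text \<open>
  Otherwise the support would lie in the trivial subgroup.
\<close>
lemma nontrivial_support:
  assumes "not_in_proper_subgroup (set_pmf p)"
  shows "\<exists>x\<in>set_pmf p. x \<noteq> (0::int)"
proof (rule ccontr)
  assume "\<not> ?thesis"
  then have sub: "set_pmf p \<subseteq> {0}" by auto
  have "subgroup {0} integer_group" by (simp add: subgroup_def)
  from assms[unfolded not_in_proper_subgroup_def, rule_format, OF this sub]
  have "(1::int) \<in> {0}" by simp
  then show False by simp
qed

context rwre
begin

sublocale walk: scenery_walk \<mu> \<nu> \<delta>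
proof
  have le: "(real_of_int x)\<^sup>2 \<le> \<bar>real_of_int x\<bar> ^ 3" for x
  proof (cases "x = 0")
    case False
    then have "1 \<le> \<bar>real_of_int x\<bar>" by linarith
    then have "\<bar>real_of_int x\<bar> ^ 2 \<le> \<bar>real_of_int x\<bar> ^ 3" by (intro power_increasing) auto
    then show ?thesis by simp
  qed simp
  show "integrable (measure_pmf \<mu>) (\<lambda>x. (real_of_int x)\<^sup>2)"
    by (rule Bochner_Integration.integrable_bound[OF mu_third_moment]) (use le in auto)
  obtain x where x: "x \<in> set_pmf \<mu>" "x \<noteq> 0" using nontrivial_support[OF mu_support] by blast
  have "- x \<in> set_pmf (map_pmf uminus \<mu>)" using x by simp
  then have "- x \<in> set_pmf \<mu>" by (simp only: mu_symmetric)
  moreover have "0 < x \<or> 0 < - x" using x(2) by linarith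
  ultimately show "\<exists>v>0. v \<in> set_pmf \<mu>" using x(1) by blast
  show "0 < \<delta>" "\<delta> < 1" by (rule delta)+
  show "map_pmf uminus \<mu> = \<mu>" by (rule mu_symmetric)
  show "integrable (measure_pmf \<nu>) (\<lambda>x. (real_of_int x)\<^sup>2)" by (rule nu_finite_variance)
  show "measure_pmf.expectation \<nu> real_of_int = 0" by (rule nu_centered)
  show "\<exists>x\<in>set_pmf \<nu>. x \<noteq> 0" by (rule nontrivial_support[OF nu_support])
qed

lemma family_rv:
  assumes "i \<in> UNIV <+> ({1..} <+> {1..})"
  shows "case_sum \<xi> (case_sum X \<epsilon>) i \<in> measurable M (count_space UNIV)"
  using indep assms unfolding indep_vars_def by (elim conjE bspec)

lemma coordinate_rv: "\<xi> y \<in> measurable M (count_space UNIV)"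
  using family_rv[OF InlI[OF UNIV_I], of y] by simp

lemma step_rv:
  assumes "1 \<le> k"
  shows "X k \<in> measurable M (count_space UNIV)" "\<epsilon> k \<in> measurable M (count_space UNIV)"
  using family_rv[of "Inr (Inl k)"] family_rv[of "Inr (Inr k)"] assms by auto

text \<open>
  The value of \<open>\<epsilon> k\<close> is \<open>0\<close> or \<open>1\<close> only almost surely; anything but \<open>1\<close> is read as vertical.
\<close>
definition step_at :: "nat \<Rightarrow> 'a \<Rightarrow> int option" where
  "step_at k \<omega> = (if \<epsilon> k \<omega> = 1 then None else Some (X k \<omega>))"

definition itinerary :: "nat \<Rightarrow> 'a \<Rightarrow> int option list" where
  "itinerary n \<omega> = map (\<lambda>k. step_at k \<omega>) [1..<Suc n]"

lemma itinerary_Suc: "itinerary (Suc n) \<omega> = itinerary n \<omega> @ [step_at (Suc n) \<omega>]"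
  by (simp add: itinerary_def)

text \<open>
  At a horizontal step the height does not move, so it makes no difference that the scenery is
  read at the height after the step.
\<close>
lemma
  assumes "\<And>k. 1 \<le> k \<Longrightarrow> k \<le> n \<Longrightarrow> \<epsilon> k \<omega> = 0 \<or> \<epsilon> k \<omega> = 1"
  shows vertical_eq_rise: "vertical X \<epsilon> n \<omega> = rise (itinerary n \<omega>)"
    and horizontal_eq_sum: "horizontal \<xi> X \<epsilon> n \<omega> = sum_list (map (\<lambda>y. \<xi> y \<omega>) (heights 0 (itinerary n \<omega>)))"
proof -
  have rise_snoc: "rise (l @ [s]) = rise l + rise [s]" for l s
    by (induction l rule: rise.induct) auto
  have "vertical X \<epsilon> n \<omega> = rise (itinerary n \<omega>) \<and>
    horizontal \<xi> X \<epsilon> n \<omega> = sum_list (map (\<lambda>y. \<xi> y \<omega>) (heights 0 (itinerary n \<omega>)))"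
    using assms
  proof (induction n)
    case 0
    show ?case by (simp add: vertical_def horizontal_def itinerary_def)
  next
    case (Suc n)
    have IH: "vertical X \<epsilon> n \<omega> = rise (itinerary n \<omega>)"
      "horizontal \<xi> X \<epsilon> n \<omega> = sum_list (map (\<lambda>y. \<xi> y \<omega>) (heights 0 (itinerary n \<omega>)))"
      using Suc by auto
    have v: "vertical X \<epsilon> (Suc n) \<omega> = vertical X \<epsilon> n \<omega> + X (Suc n) \<omega> * (1 - \<epsilon> (Suc n) \<omega>)"
      by (simp add: vertical_def)
    have h: "horizontal \<xi> X \<epsilon> (Suc n) \<omega> = horizontal \<xi> X \<epsilon> n \<omega> + \<xi> (vertical X \<epsilon> (Suc n) \<omega>) \<omega> * \<epsilon> (Suc n) \<omega>"
      by (simp add: horizontal_def)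
    have e: "\<epsilon> (Suc n) \<omega> = 0 \<or> \<epsilon> (Suc n) \<omega> = 1" using Suc.prems by simp
    show ?case
      unfolding h v IH itinerary_Suc rise_snoc heights_append using e by (auto simp: step_at_def IH)
  qed
  then show "vertical X \<epsilon> n \<omega> = rise (itinerary n \<omega>)"
    "horizontal \<xi> X \<epsilon> n \<omega> = sum_list (map (\<lambda>y. \<xi> y \<omega>) (heights 0 (itinerary n \<omega>)))" by auto
qed

lemma max_horizontal_le_iff:
  assumes "\<And>k. 1 \<le> k \<Longrightarrow> k \<le> n \<Longrightarrow> \<epsilon> k \<omega> = 0 \<or> \<epsilon> k \<omega> = 1" "1 \<le> n" "0 \<le> a"
  shows "Max ((\<lambda>k. horizontal \<xi> X \<epsilon> k \<omega>) ` {1..n}) \<le> a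
    \<longleftrightarrow> max_prefix_sum (map (\<lambda>y. \<xi> y \<omega>) (heights 0 (itinerary n \<omega>))) \<le> a"
proof -
  have "max_prefix_sum (map (\<lambda>y. \<xi> y \<omega>) (heights 0 (itinerary m \<omega>))) \<le> a \<longleftrightarrow> (\<forall>k\<in>{1..m}. horizontal \<xi> X \<epsilon> k \<omega> \<le> a)"
    if "m \<le> n" for m
    using that
  proof (induction m)
    case 0
    show ?case using assms(3) by (simp add: itinerary_def)
  next
    case (Suc m)
    have "horizontal \<xi> X \<epsilon> (Suc m) \<omega> = sum_list (map (\<lambda>y. \<xi> y \<omega>) (heights 0 (itinerary (Suc m) \<omega>)))"
      using Suc.prems assms(1) by (intro horizontal_eq_sum) auto
    then show ?case
      using Suc by (simp add: itinerary_Suc max_prefix_sum_snoc atLeastAtMostSuc_conv conj_commute)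
  qed
  then show ?thesis using assms(2) by (subst Max_le_iff) auto
qed

lemma int_op_measurable:
  fixes f g :: "'a \<Rightarrow> int"
  assumes "f \<in> measurable M (count_space UNIV)" "g \<in> measurable M (count_space UNIV)"
  shows "(\<lambda>\<omega>. h (f \<omega>) (g \<omega>) :: int) \<in> measurable M (count_space UNIV)"
  by (rule measurable_compose_countable[where f="\<lambda>i \<omega>. h i (g \<omega>)" and g=f])
     (use assms in \<open>auto intro: measurable_compose[OF assms(2)]\<close>)

lemma vertical_measurable: "vertical X \<epsilon> n \<in> measurable M (count_space UNIV)"
proof (induction n)
  case (Suc n)
  have "(\<lambda>\<omega>. vertical X \<epsilon> n \<omega> + X (Suc n) \<omega> * (1 - \<epsilon> (Suc n) \<omega>)) \<in> measurable M (count_space UNIV)"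
    by (intro int_op_measurable[where h="(+)"] int_op_measurable[where h="\<lambda>x e. x * (1 - e)"] Suc step_rv) auto
  moreover have "vertical X \<epsilon> (Suc n) = (\<lambda>\<omega>. vertical X \<epsilon> n \<omega> + X (Suc n) \<omega> * (1 - \<epsilon> (Suc n) \<omega>))"
    by (simp add: fun_eq_iff vertical_def)
  ultimately show ?case by simp
qed (simp add: vertical_def[abs_def])

lemma horizontal_measurable: "horizontal \<xi> X \<epsilon> n \<in> measurable M (count_space UNIV)"
proof (induction n)
  case (Suc n)
  have "(\<lambda>\<omega>. \<xi> (vertical X \<epsilon> (Suc n) \<omega>) \<omega>) \<in> measurable M (count_space UNIV)"
    by (rule measurable_compose_countable[OF coordinate_rv vertical_measurable])
  then have "(\<lambda>\<omega>. horizontal \<xi> X \<epsilon> n \<omega> + \<xi> (vertical X \<epsilon> (Suc n) \<omega>) \<omega> * \<epsilon> (Suc n) \<omega>) \<in> measurable M (count_space UNIV)"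
    by (intro int_op_measurable[where h="(+)"] int_op_measurable[where h="(*)"] Suc step_rv) auto
  moreover have "horizontal \<xi> X \<epsilon> (Suc n) = (\<lambda>\<omega>. horizontal \<xi> X \<epsilon> n \<omega> + \<xi> (vertical X \<epsilon> (Suc n) \<omega>) \<omega> * \<epsilon> (Suc n) \<omega>)"
    by (simp add: fun_eq_iff horizontal_def)
  ultimately show ?case by simp
qed (simp add: horizontal_def[abs_def])

lemma eps_prob: "1 \<le> k \<Longrightarrow> prob {\<omega>\<in>space M. \<epsilon> k \<omega> \<in> B} = measure_pmf.prob (map_pmf of_bool (bernoulli_pmf \<delta>)) B"
  using arg_cong[OF eps_law[of k], of "\<lambda>N. measure N B"] step_rv(2)[of k]
  by (simp add: measure_distr vimage_def Int_def conj_commute)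

lemma X_prob: "1 \<le> k \<Longrightarrow> prob {\<omega>\<in>space M. X k \<omega> \<in> B} = measure_pmf.prob \<nu> B"
  using arg_cong[OF X_law[of k], of "\<lambda>N. measure N B"] step_rv(1)[of k]
  by (simp add: measure_distr vimage_def Int_def conj_commute)

lemma eps_AE: "1 \<le> k \<Longrightarrow> AE \<omega> in M. \<epsilon> k \<omega> = 0 \<or> \<epsilon> k \<omega> = 1"
proof -
  assume k: "1 \<le> k"
  have "AE x in distr M (count_space UNIV) (\<epsilon> k). x = 0 \<or> x = 1"
    unfolding eps_law[OF k] by (auto simp: AE_measure_pmf_iff)
  then show ?thesis using step_rv(2)[OF k] by (subst (asm) AE_distr_iff) auto
qed

lemma step_at_prob:
  assumes k: "1 \<le> k"
  shows "prob {\<omega>\<in>space M. step_at k \<omega> = s} = pmf walk.step s"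
proof (cases s)
  case None
  have "prob {\<omega>\<in>space M. step_at k \<omega> = s} = prob {\<omega>\<in>space M. \<epsilon> k \<omega> \<in> {1}}"
    unfolding None by (intro arg_cong[where f=prob]) (auto simp: step_at_def split: if_splits)
  also have "\<dots> = measure_pmf.prob (bernoulli_pmf \<delta>) {True}"
    unfolding eps_prob[OF k] by (auto simp: vimage_def intro!: arg_cong[where f="measure_pmf.prob (bernoulli_pmf \<delta>)"])
  also have "\<dots> = \<delta>" using delta by (simp add: measure_pmf_single)
  also have "\<dots> = pmf walk.step s"
    unfolding None walk.step_def pmf_bind using delta by (simp add: pmf_map vimage_def)
  finally show ?thesis .
next
  case (Some x)
  let ?A = "case_sum (\<lambda>_. {}) (case_sum (\<lambda>_. {x}) (\<lambda>_. - {1}))"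
  have "prob {\<omega>\<in>space M. step_at k \<omega> = s} = prob (\<Inter>i\<in>{Inr (Inl k), Inr (Inr k)}. case_sum \<xi> (case_sum X \<epsilon>) i -` ?A i \<inter> space M)"
    unfolding Some by (intro arg_cong[where f=prob]) (auto simp: step_at_def split: if_splits)
  also have "\<dots> = (\<Prod>i\<in>{Inr (Inl k), Inr (Inr k)}. prob (case_sum \<xi> (case_sum X \<epsilon>) i -` ?A i \<inter> space M))"
    using k by (intro indep_varsD[OF indep]) auto
  also have "\<dots> = prob {\<omega>\<in>space M. X k \<omega> \<in> {x}} * prob {\<omega>\<in>space M. \<epsilon> k \<omega> \<in> - {1}}"
    by (simp add: vimage_def Int_def conj_commute)
  also have "\<dots> = pmf \<nu> x * (1 - \<delta>)"
  proof -
    have "measure_pmf.prob (map_pmf of_bool (bernoulli_pmf \<delta>)) (- {1::int}) = measure_pmf.prob (bernoulli_pmf \<delta>) {False}"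
      by (auto simp: vimage_def intro!: arg_cong[where f="measure_pmf.prob (bernoulli_pmf \<delta>)"])
    then show ?thesis unfolding X_prob[OF k] eps_prob[OF k] using delta by (simp add: measure_pmf_single)
  qed
  also have "\<dots> = pmf walk.step s"
    unfolding Some walk.step_def pmf_bind using delta by (simp add: pmf_map_inj')
  finally show ?thesis .
qed

lemma scenery_prob:
  "prob {\<omega>\<in>space M. P (map (\<lambda>y. \<xi> y \<omega>) ps)} = walk.scenery.prob {\<xi>. P (map \<xi> ps)}"
proof -
  let ?I = "range Inl :: (int + nat + nat) set"
  let ?Y = "case_sum \<xi> (case_sum X \<epsilon>)"
  let ?N = "PiM ?I (\<lambda>_. measure_pmf \<mu>)"
  have rv: "?Y i \<in> measurable M (count_space UNIV)" if "i \<in> ?I" for i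
    using that coordinate_rv by auto
  have "indep_vars (\<lambda>_. count_space UNIV) ?Y ?I"
    by (rule indep_vars_subset[OF indep]) auto
  then have "distr M (PiM ?I (\<lambda>_. count_space UNIV)) (\<lambda>\<omega>. \<lambda>i\<in>?I. ?Y i \<omega>) = PiM ?I (\<lambda>i. distr M (count_space UNIV) (?Y i))"
    using rv by (subst (asm) indep_vars_iff_distr_eq_PiM') auto
  also have "\<dots> = ?N" by (intro PiM_cong) (auto simp: xi_law)
  finally have d1: "distr M (PiM ?I (\<lambda>_. count_space UNIV)) (\<lambda>\<omega>. \<lambda>i\<in>?I. ?Y i \<omega>) = ?N" .
  have d2: "distr ?N walk.scenery (\<lambda>f. \<lambda>n\<in>UNIV. f (Inl n)) = walk.scenery"
    unfolding walk.scenery_def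
    by (rule distr_PiM_reindex[of ?I "\<lambda>_. measure_pmf \<mu>" Inl UNIV]) (auto intro: measure_pmf.prob_space_axioms)
  have restrict_all: "restrict f UNIV = f" for f :: "int \<Rightarrow> int" by (simp add: restrict_def)
  let ?E = "{\<xi>. P (map \<xi> ps)}"
  have m1: "(\<lambda>\<omega>. \<lambda>i\<in>?I. ?Y i \<omega>) \<in> measurable M (PiM ?I (\<lambda>_. count_space UNIV))"
    using rv by (intro measurable_restrict) auto
  have m2: "(\<lambda>f. \<lambda>n\<in>UNIV. f (Inl n)) \<in> measurable ?N walk.scenery"
    unfolding walk.scenery_def by (intro measurable_restrict measurable_component_singleton) auto
  have sets_eq: "sets (PiM ?I (\<lambda>_. count_space UNIV)) = sets ?N" by (intro sets_PiM_cong) auto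
  have sp: "space ?N = space (PiM ?I (\<lambda>_. count_space UNIV))" using sets_eq by (rule sets_eq_imp_space_eq[symmetric])
  let ?F = "(\<lambda>f. \<lambda>n\<in>UNIV. f (Inl n)) -` ?E \<inter> space ?N"
  have F: "?F \<in> sets ?N" by (rule measurable_sets[OF m2 walk.sample_event])
  have "walk.scenery.prob ?E = measure (distr ?N walk.scenery (\<lambda>f. \<lambda>n\<in>UNIV. f (Inl n))) ?E"
    by (simp only: d2)
  also have "\<dots> = measure ?N ?F"
    by (rule measure_distr[OF m2 walk.sample_event])
  also have "\<dots> = measure (distr M (PiM ?I (\<lambda>_. count_space UNIV)) (\<lambda>\<omega>. \<lambda>i\<in>?I. ?Y i \<omega>)) ?F"
    by (simp only: d1)
  also have "\<dots> = prob ((\<lambda>\<omega>. \<lambda>i\<in>?I. ?Y i \<omega>) -` ?F \<inter> space M)"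
    using F sets_eq by (intro measure_distr[OF m1]) auto
  also have "(\<lambda>\<omega>. \<lambda>i\<in>?I. ?Y i \<omega>) -` ?F \<inter> space M = {\<omega>\<in>space M. P (map (\<lambda>y. \<xi> y \<omega>) ps)}"
    using measurable_space[OF m1] by (auto simp: sp restrict_all)
  finally show ?thesis ..
qed

lemma step_at_measurable:
  assumes "1 \<le> k"
  shows "step_at k \<in> measurable M (count_space UNIV)"
proof -
  have "(\<lambda>\<omega>. if \<epsilon> k \<omega> = 1 then None else Some (X k \<omega>)) \<in> measurable M (count_space UNIV)"
    by (rule measurable_compose_countable[where f="\<lambda>e \<omega>. if e = 1 then None else Some (X k \<omega>)" and g="\<epsilon> k"])
       (auto intro: step_rv assms measurable_compose[OF step_rv(1)[OF assms]])
  then show ?thesis by (simp add: step_at_def[abs_def])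
qed

lemma itinerary_measurable: "itinerary n \<in> measurable M (count_space UNIV)"
  unfolding itinerary_def[abs_def] by (rule map_measurable) (auto intro: step_at_measurable)

lemma sample_rv: "(\<lambda>\<omega>. map (\<lambda>y. \<xi> y \<omega>) ps) \<in> measurable M (count_space UNIV)"
  by (rule map_measurable) (auto intro: coordinate_rv)

text \<open>
  The joint independence is regrouped into one block for the whole scenery and one block for each
  time, the latter made of \<open>X k\<close> and \<open>\<epsilon> k\<close>.
\<close>
lemma path_and_scenery:
  assumes l: "length l = n"
  shows "prob {\<omega>\<in>space M. itinerary n \<omega> = l \<and> P (map (\<lambda>y. \<xi> y \<omega>) ps)}
    = pmf (walk.paths n) l * walk.scenery.prob {\<xi>. P (map \<xi> ps)}"
proof -
  let ?Y = "case_sum \<xi> (case_sum X \<epsilon>)"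
  let ?L = "insert None (Some ` {..<n})"
  define K :: "nat option \<Rightarrow> (int + nat + nat) set" where
    "K = case_option (range Inl) (\<lambda>i. {Inr (Inl (Suc i)), Inr (Inr (Suc i))})"
  let ?N = "\<lambda>j. PiM (K j) (\<lambda>_. count_space UNIV :: int measure)"
  let ?R = "\<lambda>j \<omega>. restrict (\<lambda>i. ?Y i \<omega>) (K j)"
  define st :: "nat \<Rightarrow> (int + nat + nat \<Rightarrow> int) \<Rightarrow> int option" where
    "st i f = (if f (Inr (Inr (Suc i))) = 1 then None else Some (f (Inr (Inl (Suc i)))))" for i f
  define A where "A = case_option {f \<in> space (?N None). P (map (\<lambda>y. f (Inl y)) ps)}
    (\<lambda>i. {f \<in> space (?N (Some i)). st i f = l ! i})"
  have ind: "indep_vars ?N ?R ?L"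
    by (rule indep_vars_restrict[OF indep]) (auto simp: K_def disjoint_family_on_def)
  have comp: "(\<lambda>f. f i) \<in> measurable (?N j) (count_space UNIV)" if "i \<in> K j" for i j
    using measurable_component_singleton[OF that, of "\<lambda>_. count_space UNIV"] by simp
  have A: "A j \<in> sets (?N j)" if "j \<in> ?L" for j
  proof (cases j)
    case None
    have "(\<lambda>f. map (\<lambda>y. f (Inl y)) ps) \<in> measurable (?N None) (count_space UNIV)"
      by (rule map_measurable, rule comp) (auto simp: K_def)
    from measurable_sets[OF this, of "{as. P as}"] show ?thesis
      by (simp add: None A_def vimage_def Int_def conj_commute)
  next
    case (Some i)
    have "st i \<in> measurable (?N (Some i)) (count_space UNIV)"
      unfolding st_def[abs_def]
      by (rule measurable_compose_countable[where f="\<lambda>e f. if e = 1 then None else Some (f (Inr (Inl (Suc i))))"])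
         (auto simp: K_def intro!: comp measurable_compose[OF comp, of _ _ Some])
    from measurable_sets[OF this, of "{l ! i}"] show ?thesis
      by (simp add: Some A_def vimage_def Int_def conj_commute)
  qed
  have rs: "?R j \<omega> \<in> space (?N j)" for j \<omega>
    by (simp add: space_PiM)
  have eN: "?R None -` A None \<inter> space M = {\<omega>\<in>space M. P (map (\<lambda>y. \<xi> y \<omega>) ps)}"
    using rs[of _ None] by (auto simp: A_def K_def)
  have eS: "?R (Some i) -` A (Some i) \<inter> space M = {\<omega>\<in>space M. step_at (Suc i) \<omega> = l ! i}" for i
    using rs[of _ "Some i"] by (auto simp: A_def K_def st_def step_at_def)
  have path_eq: "itinerary n \<omega> = l \<longleftrightarrow> (\<forall>i<n. step_at (Suc i) \<omega> = l ! i)" for \<omega>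
    using l by (auto simp: itinerary_def list_eq_iff_nth_eq simp del: upt_Suc)
  have "(\<Inter>j\<in>?L. ?R j -` A j \<inter> space M)
    = (?R None -` A None \<inter> space M) \<inter> (\<Inter>i\<in>{..<n}. ?R (Some i) -` A (Some i) \<inter> space M)"
    by (simp only: INT_insert INT_extend_simps image_image)
  also have "\<dots> = {\<omega>\<in>space M. itinerary n \<omega> = l \<and> P (map (\<lambda>y. \<xi> y \<omega>) ps)}"
    unfolding eN eS path_eq by auto
  finally have "{\<omega>\<in>space M. itinerary n \<omega> = l \<and> P (map (\<lambda>y. \<xi> y \<omega>) ps)} = (\<Inter>j\<in>?L. ?R j -` A j \<inter> space M)" ..
  also have "prob \<dots> = (\<Prod>j\<in>?L. prob (?R j -` A j \<inter> space M))"
    by (rule indep_varsD_finite[OF ind]) (use A in auto)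
  also have "\<dots> = prob (?R None -` A None \<inter> space M) * (\<Prod>j\<in>Some ` {..<n}. prob (?R j -` A j \<inter> space M))"
    by (subst prod.insert) auto
  also have "(\<Prod>j\<in>Some ` {..<n}. prob (?R j -` A j \<inter> space M)) = (\<Prod>i<n. prob (?R (Some i) -` A (Some i) \<inter> space M))"
    by (subst prod.reindex) auto
  also have "\<dots> = (\<Prod>i<n. pmf walk.step (l ! i))"
    by (intro prod.cong refl, subst eS, rule step_at_prob) simp
  also have "\<dots> = pmf (walk.paths n) l" using l by (rule pmf_replicate[symmetric])
  finally show ?thesis unfolding eN scenery_prob by (simp only: mult.commute)
qed

text \<open>
  The bridge to the process itself: path and scenery are independent, so the annealed
  probability is the average over paths of quenched probabilities.
\<close>
lemma max_horizontal_prob: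
  assumes n: "1 \<le> n" and a: "0 \<le> a"
  shows "ennreal (prob {\<omega>\<in>space M. Max ((\<lambda>k. horizontal \<xi> X \<epsilon> k \<omega>) ` {1..n}) \<le> a}) = walk.persistence a n"
proof -
  let ?A = "{\<omega>\<in>space M. Max ((\<lambda>k. horizontal \<xi> X \<epsilon> k \<omega>) ` {1..n}) \<le> a}"
  let ?B = "\<lambda>l. {\<omega>\<in>space M. itinerary n \<omega> = l \<and> max_prefix_sum (map (\<lambda>y. \<xi> y \<omega>) (heights 0 l)) \<le> a}"
  have A: "?A \<in> events"
  proof -
    have "?A = (\<Inter>k\<in>{1..n}. {\<omega>\<in>space M. horizontal \<xi> X \<epsilon> k \<omega> \<le> a})"
      using n by (auto simp: Max_le_iff)
    also have "\<dots> \<in> events"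
    proof (rule sets.finite_INT)
      fix k
      show "{\<omega>\<in>space M. horizontal \<xi> X \<epsilon> k \<omega> \<le> a} \<in> events"
        using measurable_sets[OF horizontal_measurable, of "{..a}" k] by (simp add: vimage_def Int_def conj_commute)
    qed (use n in auto)
    finally show ?thesis .
  qed
  have B: "?B l \<in> events" for l
  proof -
    note [measurable] = itinerary_measurable measurable_compose[OF sample_rv, of max_prefix_sum "count_space UNIV"]
    show ?thesis by measurable
  qed
  have U: "(\<Union>l. ?B l) \<in> events" using B by (intro sets.countable_UN') auto
  \<comment> \<open>Outside this null set the process and its encoding by steps agree.\<close>
  have "AE \<omega> in M. \<forall>k\<in>{1..n}. \<epsilon> k \<omega> = 0 \<or> \<epsilon> k \<omega> = 1"
    by (intro AE_finite_allI) (auto intro: eps_AE)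
  then have "AE \<omega> in M. \<omega> \<in> ?A \<longleftrightarrow> \<omega> \<in> (\<Union>l. ?B l)"
  proof eventually_elim
    case (elim \<omega>)
    then show ?case using max_horizontal_le_iff[of n \<omega> a] n a by auto
  qed
  then have "emeasure M ?A = emeasure M (\<Union>l. ?B l)" by (rule emeasure_eq_AE[OF _ A U])
  also have "\<dots> = (\<integral>\<^sup>+l. emeasure M (?B l) \<partial>count_space UNIV)"
    using B by (intro emeasure_UN_countable) (auto simp: disjoint_family_on_def)
  also have "\<dots> = (\<integral>\<^sup>+l. ennreal (pmf (walk.paths n) l) * emeasure walk.scenery {\<xi>. max_prefix_sum (map \<xi> (heights 0 l)) \<le> a} \<partial>count_space UNIV)"
  proof (intro nn_integral_cong)
    fix l
    show "emeasure M (?B l) = ennreal (pmf (walk.paths n) l) * emeasure walk.scenery {\<xi>. max_prefix_sum (map \<xi> (heights 0 l)) \<le> a}"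
    proof (cases "length l = n")
      case True
      show ?thesis
        unfolding emeasure_eq_measure walk.scenery.emeasure_eq_measure
          path_and_scenery[OF True, of "\<lambda>as. max_prefix_sum as \<le> a"]
        by (simp add: ennreal_mult pmf_nonneg)
    next
      case False
      then have empty: "?B l = {}" by (auto simp: itinerary_def)
      have "l \<notin> set_pmf (walk.paths n)" using False by (simp add: set_replicate_pmf)
      then show ?thesis unfolding empty by (simp add: set_pmf_iff)
    qed
  qed
  also have "\<dots> = walk.persistence a n"
    unfolding walk.persistence_def by (rule nn_integral_measure_pmf[symmetric])
  finally show ?thesis by (simp add: emeasure_eq_measure)
qed

section \<open>The exponential tail and the two bounds\<close>

lemma exp_integrable_iff:
  "integrable M (\<lambda>\<omega>. exp (real_of_int (\<xi> y \<omega>))) \<longleftrightarrow> integrable (measure_pmf \<mu>) (\<lambda>x. exp (real_of_int x))"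
  unfolding xi_law[symmetric, of y] using coordinate_rv by (subst integrable_distr_eq) auto

lemma exp_tail_eq:
  "exp_tail M (\<xi> y) t = (\<integral>x. exp (real_of_int x) * indicator {x. t < exp (real_of_int x)} x \<partial>measure_pmf \<mu>)"
  unfolding xi_law[symmetric, of y] exp_tail_def using coordinate_rv
  by (subst integral_distr) (auto intro!: Bochner_Integration.integral_cong simp: indicator_def)

lemma exp_tail_tendsto:
  assumes int: "integrable (measure_pmf \<mu>) (\<lambda>x. exp (real_of_int x))"
  shows "(\<lambda>n. exp_tail M (\<xi> y) (real n)) \<longlonglongrightarrow> 0"
proof -
  have "(\<lambda>n. \<integral>x. exp (real_of_int x) * indicator {x. real n < exp (real_of_int x)} x \<partial>measure_pmf \<mu>)
     \<longlonglongrightarrow> (\<integral>x. 0 \<partial>measure_pmf \<mu>)"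
  proof (rule integral_dominated_convergence[OF _ _ int])
    show "AE x in measure_pmf \<mu>. (\<lambda>n. exp (real_of_int x) * indicator {x. real n < exp (real_of_int x)} x) \<longlonglongrightarrow> 0"
    proof (rule AE_I2)
      fix x :: int
      have "\<forall>\<^sub>F n in sequentially. exp (real_of_int x) \<le> real n"
        using filterlim_real_sequentially unfolding filterlim_at_top by blast
      then have "\<forall>\<^sub>F n in sequentially. exp (real_of_int x) * indicator {x. real n < exp (real_of_int x)} x = (0::real)"
        by eventually_elim (auto simp: indicator_def)
      then show "(\<lambda>n. exp (real_of_int x) * indicator {x. real n < exp (real_of_int x)} x) \<longlonglongrightarrow> (0::real)"
        by (rule tendsto_eventually)
    qed
  qed (auto simp: indicator_def)
  then show ?thesis by (simp add: exp_tail_eq)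
qed

text \<open>
  The scenery takes some value \<open>v > 0\<close>, hence the tail function stays above a positive constant on
  \<open>t < 1\<close>. Dominated convergence makes the set in the infimum nonempty, without which the infimum
  would be an arbitrary real.
\<close>
lemma generalized_inverse_exp_tail_ge_one:
  assumes int: "integrable (measure_pmf \<mu>) (\<lambda>x. exp (real_of_int x))"
  shows "\<exists>h>0. \<forall>x. 0 < x \<longrightarrow> x < h \<longrightarrow> 1 \<le> generalized_inverse (exp_tail M (\<xi> y)) x"
proof -
  obtain v where v: "0 < v" "v \<in> set_pmf \<mu>" using walk.mu_nontrivial by blast
  define h where "h = exp (real_of_int v) * pmf \<mu> v"
  have "1 \<le> generalized_inverse (exp_tail M (\<xi> y)) x" if x: "0 < x" "x < h" for x
    unfolding generalized_inverse_def
  proof (rule cInf_greatest)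
    have "\<forall>\<^sub>F n in sequentially. exp_tail M (\<xi> y) (real n) < x"
      using exp_tail_tendsto[OF int, of y] x(1) by (rule order_tendstoD)
    then have "\<forall>\<^sub>F n in sequentially. exp_tail M (\<xi> y) (real n) < x \<and> 0 < n"
      using eventually_gt_at_top[of 0] by eventually_elim auto
    then obtain n :: nat where "exp_tail M (\<xi> y) (real n) < x" "0 < n"
      using eventually_happens'[OF sequentially_bot] by blast
    then show "{t. 0 < t \<and> exp_tail M (\<xi> y) t < x} \<noteq> {}" by (auto intro!: exI[of _ "real n"])
  next
    fix t assume t: "t \<in> {t. 0 < t \<and> exp_tail M (\<xi> y) t < x}"
    show "1 \<le> t"
    proof (rule ccontr)
      assume "\<not> 1 \<le> t"
      have "h = (\<integral>x. exp (real_of_int v) * indicator {v} x \<partial>measure_pmf \<mu>)"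
        by (simp add: h_def measure_pmf_single)
      also have "\<dots> \<le> (\<integral>x. exp (real_of_int x) * indicator {x. t < exp (real_of_int x)} x \<partial>measure_pmf \<mu>)"
      proof (rule integral_mono)
        show "integrable (measure_pmf \<mu>) (\<lambda>x. exp (real_of_int v) * indicator {v} x)"
          by (rule measure_pmf.integrable_const_bound[where B="exp (real_of_int v)"]) (auto intro!: AE_I2 simp: indicator_def)
        show "integrable (measure_pmf \<mu>) (\<lambda>x. exp (real_of_int x) * indicator {x. t < exp (real_of_int x)} x)"
          by (rule Bochner_Integration.integrable_bound[OF int]) (auto simp: indicator_def)
        fix x
        have "1 < exp (real_of_int v)" using v(1) by simp
        then have "t < exp (real_of_int v)" using \<open>\<not> 1 \<le> t\<close> by linarith
        then show "exp (real_of_int v) * indicator {v} x \<le> exp (real_of_int x) * indicator {x. t < exp (real_of_int x)} x"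
          by (auto simp: indicator_def)
      qed
      also have "\<dots> = exp_tail M (\<xi> y) t" by (rule exp_tail_eq[symmetric])
      finally show False using t x(2) by simp
    qed
  qed
  moreover have "0 < h" using v(2) by (simp add: h_def pmf_positive)
  ultimately show ?thesis by blast
qed

lemma max_horizontal_upper:
  "\<exists>c>0. \<forall>\<^sub>F T :: nat in sequentially.
     prob {\<omega> \<in> space M. Max ((\<lambda>k. horizontal \<xi> X \<epsilon> k \<omega>) ` {1..T}) \<le> 1}
       \<le> real T powr (-1/4) * ln (real T) powr c"
proof -
  obtain C where C: "0 < C" "\<And>n. walk.persistence 1 n \<le> ennreal (C * real (n + 1) powr (-1/4))"
    using walk.persistence_upper by blast
  have "\<forall>\<^sub>F T :: nat in sequentially. C \<le> ln (real T)" by real_asymp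
  moreover have "\<forall>\<^sub>F T :: nat in sequentially. 1 \<le> T" by (rule eventually_ge_at_top)
  ultimately have "\<forall>\<^sub>F T :: nat in sequentially.
     prob {\<omega> \<in> space M. Max ((\<lambda>k. horizontal \<xi> X \<epsilon> k \<omega>) ` {1..T}) \<le> 1}
       \<le> real T powr (-1/4) * ln (real T) powr 1"
  proof eventually_elim
    case (elim T)
    let ?p = "prob {\<omega> \<in> space M. Max ((\<lambda>k. horizontal \<xi> X \<epsilon> k \<omega>) ` {1..T}) \<le> 1}"
    have "ennreal ?p \<le> ennreal (C * real (T + 1) powr (-1/4))"
      unfolding max_horizontal_prob[OF elim(2) zero_le_one] by (rule C(2))
    then have "?p \<le> C * real (T + 1) powr (-1/4)" using C(1) by (subst (asm) ennreal_le_iff) auto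
    also have "\<dots> \<le> ln (real T) * real T powr (-1/4)"
      using elim C(1) by (intro mult_mono powr_mono2') auto
    finally show ?case using elim C(1) by (simp add: mult.commute)
  qed
  then show ?thesis by (intro exI[of _ 1]) auto
qed

text \<open>
  Since the inverse of \<^const>\<open>exp_tail\<close> is eventually at least \<open>1\<close>, it suffices to bound the
  probability from below by a multiple of \<open>T powr (-1/4) / ln T\<close>; a further logarithm absorbs the
  constant.
\<close>
lemma max_horizontal_lower:
  assumes "integrable M (\<lambda>\<omega>. exp (real_of_int (\<xi> 1 \<omega>)))"
  shows "\<forall>\<^sub>F T :: nat in sequentially.
     real T powr (-1/4) * ln (real T) powr (-2)
         * inverse (generalized_inverse (exp_tail M (\<xi> 1)) (1 * real T powr (-1/4)))
       \<le> prob {\<omega> \<in> space M. Max ((\<lambda>k. horizontal \<xi> X \<epsilon> k \<omega>) ` {1..T}) \<le> 1}"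
proof -
  have int: "integrable (measure_pmf \<mu>) (\<lambda>x. exp (real_of_int x))"
    using assms by (simp only: exp_integrable_iff)
  obtain c where c: "0 < c" "\<forall>\<^sub>F T in sequentially. ennreal (c * real T powr (-1/4) / ln (real T)) \<le> walk.persistence 1 T"
    using walk.persistence_lower[OF int] by blast
  obtain h where h: "0 < h" "\<And>x. 0 < x \<Longrightarrow> x < h \<Longrightarrow> 1 \<le> generalized_inverse (exp_tail M (\<xi> 1)) x"
    using generalized_inverse_exp_tail_ge_one[OF int] by blast
  have "\<forall>\<^sub>F T :: nat in sequentially. 1 / ln (real T) \<le> c" using c(1) by real_asymp
  moreover have "\<forall>\<^sub>F T :: nat in sequentially. real T powr (-1/4) < h" using h(1) by real_asymp
  moreover have "\<forall>\<^sub>F T :: nat in sequentially. 0 < ln (real T)" by real_asymp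
  moreover have "\<forall>\<^sub>F T :: nat in sequentially. 1 \<le> T" by (rule eventually_ge_at_top)
  ultimately show ?thesis using c(2)
  proof eventually_elim
    case (elim T)
    let ?p = "prob {\<omega> \<in> space M. Max ((\<lambda>k. horizontal \<xi> X \<epsilon> k \<omega>) ` {1..T}) \<le> 1}"
    let ?g = "generalized_inverse (exp_tail M (\<xi> 1)) (1 * real T powr (-1/4))"
    have g: "1 \<le> ?g" using h(2)[of "real T powr (-1/4)"] elim by simp
    have "ln (real T) powr (-2) = 1 / ln (real T) * (1 / ln (real T))"
      using elim(3) by (simp add: powr_minus powr_numeral power2_eq_square divide_simps)
    also have "\<dots> \<le> c * (1 / ln (real T))"
      using elim by (intro mult_right_mono) auto
    finally have "real T powr (-1/4) * ln (real T) powr (-2) * inverse ?g \<le> real T powr (-1/4) * (c * (1 / ln (real T))) * 1"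
      using g elim(3) c(1) by (intro mult_mono mult_left_mono) (auto simp: inverse_le_1_iff)
    also have "\<dots> = c * real T powr (-1/4) / ln (real T)" by simp
    also have "\<dots> \<le> ?p"
      using elim(5) unfolding max_horizontal_prob[OF elim(4) zero_le_one, symmetric]
      by (subst (asm) ennreal_le_iff) auto
    finally show ?case .
  qed
qed

end

theorem theorem2:
  fixes M :: "'a measure"
    and \<xi> :: "int \<Rightarrow> 'a \<Rightarrow> int"
    and X :: "nat \<Rightarrow> 'a \<Rightarrow> int"
    and \<epsilon> :: "nat \<Rightarrow> 'a \<Rightarrow> int"
    and \<mu> \<nu> :: "int pmf"
    and \<delta> :: real
  assumes "rwre M \<xi> X \<epsilon> \<mu> \<nu> \<delta>"
  shows "(\<exists>c>0. \<forall>\<^sub>F T :: nat in sequentially.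
            measure M {\<omega> \<in> space M. Max ((\<lambda>k. horizontal \<xi> X \<epsilon> k \<omega>) ` {1..T}) \<le> 1}
              \<le> real T powr (-1/4) * ln (real T) powr c)
       \<and> (integrable M (\<lambda>\<omega>. exp (real_of_int (\<xi> 1 \<omega>))) \<longrightarrow>
          (\<exists>c'>0. \<exists>c''>0. \<exists>T\<^sub>0>0. \<forall>T :: nat. real T > T\<^sub>0 \<longrightarrow>
            real T powr (-1/4) * ln (real T) powr (-c')
                * inverse (generalized_inverse (exp_tail M (\<xi> 1)) (c'' * real T powr (-1/4)))
              \<le> measure M {\<omega> \<in> space M. Max ((\<lambda>k. horizontal \<xi> X \<epsilon> k \<omega>) ` {1..T}) \<le> 1}))"
proof -
  interpret rwre M \<xi> X \<epsilon> \<mu> \<nu> \<delta> by fact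
  show ?thesis
  proof (intro conjI impI)
    show "\<exists>c>0. \<forall>\<^sub>F T :: nat in sequentially.
            measure M {\<omega> \<in> space M. Max ((\<lambda>k. horizontal \<xi> X \<epsilon> k \<omega>) ` {1..T}) \<le> 1}
              \<le> real T powr (-1/4) * ln (real T) powr c"
      by (rule max_horizontal_upper)
  next
    assume "integrable M (\<lambda>\<omega>. exp (real_of_int (\<xi> 1 \<omega>)))"
    from max_horizontal_lower[OF this] obtain N :: nat where
      le: "\<And>T. N \<le> T \<Longrightarrow> real T powr (-1/4) * ln (real T) powr (-2)
         * inverse (generalized_inverse (exp_tail M (\<xi> 1)) (1 * real T powr (-1/4)))
       \<le> measure M {\<omega> \<in> space M. Max ((\<lambda>k. horizontal \<xi> X \<epsilon> k \<omega>) ` {1..T}) \<le> 1}"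
      unfolding eventually_sequentially by blast
    have "\<forall>T :: nat. real T > real N + 1 \<longrightarrow>
            real T powr (-1/4) * ln (real T) powr (-2)
                * inverse (generalized_inverse (exp_tail M (\<xi> 1)) (1 * real T powr (-1/4)))
              \<le> measure M {\<omega> \<in> space M. Max ((\<lambda>k. horizontal \<xi> X \<epsilon> k \<omega>) ` {1..T}) \<le> 1}"
    proof (intro allI impI)
      fix T :: nat assume "real T > real N + 1"
      then have "N \<le> T" by linarith
      then show "real T powr (-1/4) * ln (real T) powr (-2)
                * inverse (generalized_inverse (exp_tail M (\<xi> 1)) (1 * real T powr (-1/4)))
              \<le> measure M {\<omega> \<in> space M. Max ((\<lambda>k. horizontal \<xi> X \<epsilon> k \<omega>) ` {1..T}) \<le> 1}"
        by (rule le)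
    qed
    moreover have "0 < (2::real)" "0 < (1::real)" "0 < real N + 1" by auto
    ultimately show "\<exists>c'>0. \<exists>c''>0. \<exists>T\<^sub>0>0. \<forall>T :: nat. real T > T\<^sub>0 \<longrightarrow>
            real T powr (-1/4) * ln (real T) powr (-c')
                * inverse (generalized_inverse (exp_tail M (\<xi> 1)) (c'' * real T powr (-1/4)))
              \<le> measure M {\<omega> \<in> space M. Max ((\<lambda>k. horizontal \<xi> X \<epsilon> k \<omega>) ` {1..T}) \<le> 1}"
      by blast
  qed
qed

end
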